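(* In critical bond percolation on $\mathbb{Z}^2$, $$\mathbf{E}\big[(\mathrm{dist}_{chem}((0,0),(1,0)))^2\,\big|\,(0,0)\leftrightarrow(1,0)\big]=\infty.$$
   Context: $\mathbf{P}$ is the critical bond percolation measure on the square lattice $\mathbb{Z}^2$ with nearest-neighbor edges: each edge is independently open or closed with probability $1/2$; $\mathbf{E}$ is expectation. $\{x\leftrightarrow y\}$ is the event that $x$ and $y$ are connected by an open path (anywhere in the plane). On this event, $\mathrm{dist}_{chem}(x,y)$ is the least number of edges in any open path connecting $x$ to $y$. *)

theory Defs
  imports "HOL-Probability.Probability"
begin

type_synonym vertex = "int \<times> int"
type_synonym edge = "vertex set"

definition adjacent :: "vertex \<Rightarrow> vertex \<Rightarrow> bool" where
  "adjacent u v \<longleftrightarrow> \<bar>fst u - fst v\<bar> + \<bar>snd u - snd v\<bar> = 1"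

definition lattice_edges :: "edge set" where
  "lattice_edges = {{u, v} | u v. adjacent u v}"

text \<open>A configuration maps an edge to \<^term>\<open>True\<close> if it is open and to \<^term>\<open>False\<close> if it is closed;
  only its values on the lattice edges carry information.\<close>

definition critical_percolation :: "(edge \<Rightarrow> bool) measure" where
  "critical_percolation = (\<Pi>\<^sub>M e\<in>lattice_edges. measure_pmf (bernoulli_pmf (1/2)))"

text \<open>A path is given by its vertices in order and may revisit vertices. It has one edge fewer than
  vertices, counted with multiplicity. A shortest path is self-avoiding, so neither connectivity
  nor the chemical distance changes if paths are required to be self-avoiding.\<close>

definition open_path :: "(edge \<Rightarrow> bool) \<Rightarrow> vertex \<Rightarrow> vertex list \<Rightarrow> vertex \<Rightarrow> bool" where
  "open_path \<omega> x p y \<longleftrightarrow> p \<noteq> [] \<and> hd p = x \<and> last p = y \<and>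
     successively (\<lambda>u v. adjacent u v \<and> \<omega> {u, v}) p"

definition path_connected_to :: "(edge \<Rightarrow> bool) \<Rightarrow> vertex \<Rightarrow> vertex \<Rightarrow> bool" where
  "path_connected_to \<omega> x y \<longleftrightarrow> (\<exists>p. open_path \<omega> x p y)"

definition connection_event :: "vertex \<Rightarrow> vertex \<Rightarrow> (edge \<Rightarrow> bool) set" where
  "connection_event x y = {\<omega> \<in> space critical_percolation. path_connected_to \<omega> x y}"

text \<open>Meaningful only if \<^term>\<open>path_connected_to \<omega> x y\<close>; otherwise the value is unspecified.\<close>

definition chem_dist :: "(edge \<Rightarrow> bool) \<Rightarrow> vertex \<Rightarrow> vertex \<Rightarrow> nat" where
  "chem_dist \<omega> x y = (LEAST n. \<exists>p. open_path \<omega> x p y \<and> length p - 1 = n)"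

text \<open>The event and the random variable are measurable and the event has positive probability, so
  conditioning on it by means of \<^const>\<open>uniform_measure\<close> is meaningful.\<close>

lemma prob_space_critical_percolation: "prob_space critical_percolation"
  unfolding critical_percolation_def
  by (intro prob_space_PiM prob_space_measure_pmf)

lemma measurable_open_edge:
  assumes "adjacent u v"
  shows "Measurable.pred critical_percolation (\<lambda>\<omega>. \<omega> {u, v})"
proof -
  have "{u, v} \<in> lattice_edges"
    using assms unfolding lattice_edges_def by blast
  then have "(\<lambda>\<omega>. \<omega> {u, v}) \<in> critical_percolation \<rightarrow>\<^sub>M measure_pmf (bernoulli_pmf (1/2))"
    unfolding critical_percolation_def by (rule measurable_component_singleton)
  then show ?thesis
    by (simp cong: measurable_cong_sets)
qed

lemma measurable_open_path [measurable]:
  "Measurable.pred critical_percolation (\<lambda>\<omega>. open_path \<omega> x p y)"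
proof -
  have step: "Measurable.pred critical_percolation (\<lambda>\<omega>. adjacent u v \<and> \<omega> {u, v})" for u v
    by (cases "adjacent u v") (simp_all add: measurable_open_edge)
  have "Measurable.pred critical_percolation
      (\<lambda>\<omega>. successively (\<lambda>u v. adjacent u v \<and> \<omega> {u, v}) p)"
  proof (induction p rule: induct_list012)
    case (3 u v p)
    show ?case
      using pred_intros_logic(3)[OF step "3.IH"(2), of u v] by simp
  qed simp_all
  then show ?thesis
    unfolding open_path_def by (intro pred_intros_logic) simp_all
qed

lemma measurable_chem_dist [measurable]:
  "(\<lambda>\<omega>. chem_dist \<omega> x y) \<in> critical_percolation \<rightarrow>\<^sub>M count_space UNIV"
  unfolding chem_dist_def by measurable

lemma sets_connection_event [measurable]: "connection_event x y \<in> sets critical_percolation"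
  unfolding connection_event_def path_connected_to_def by measurable

lemma connection_event_pos:
  assumes "adjacent x y"
  shows "emeasure critical_percolation (connection_event x y) > 0"
proof -
  interpret product_prob_space "\<lambda>_. measure_pmf (bernoulli_pmf (1/2))" lattice_edges
    by unfold_locales
  have e: "{x, y} \<in> lattice_edges"
    using assms unfolding lattice_edges_def by blast
  have "0 < emeasure (measure_pmf (bernoulli_pmf (1/2))) {True}"
    by (simp add: emeasure_pmf_single zero_less_iff_neq_zero)
  also have "\<dots> = emeasure critical_percolation {\<omega> \<in> space critical_percolation. \<omega> {x, y} \<in> {True}}"
    unfolding critical_percolation_def using e by (intro emeasure_PiM_Collect_single[symmetric]) auto
  also have "\<dots> \<le> emeasure critical_percolation (connection_event x y)"
  proof (rule emeasure_mono)
    show "{\<omega> \<in> space critical_percolation. \<omega> {x, y} \<in> {True}} \<subseteq> connection_event x y"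
      using assms by (auto simp: connection_event_def path_connected_to_def open_path_def
        intro!: exI[of _ "[x, y]"])
  qed measurable
  finally show ?thesis .
qed

end

theory Submission
  imports Defs
begin

text \<open>
  Let \<open>e\<close> be the bond joining \<open>x = (0, 0)\<close> and \<open>y = (1, 0)\<close>. It suffices to show that, for every \<open>k\<close>,
  with probability at least a constant times \<open>1 / k\<^sup>2\<close> the vertices \<open>x\<close> and \<open>y\<close> are connected but not by a
  path of length at most \<open>k\<close>: summing the tail against \<open>2k + 1\<close> then gives a harmonic series.

  For a percolation configuration on the torus of side \<open>N\<close>, consider the linear space of periods of the functions
  on its universal cover that are constant on clusters and additively periodic. The dual configuration has
  the orthogonal complement as its space of periods, hence a different one. By self-duality no value of this
  invariant has probability more than \<open>1/2\<close>, so two independent configurations differ in it with probability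
  at least \<open>1/2\<close>. Resampling the bonds one at a time shows that some bond, and by symmetry the bond \<open>e\<close>, is
  pivotal with probability at least \<open>1 / (4N\<^sup>2)\<close>. If \<open>e\<close> is pivotal, then its end points are joined by no short path
  avoiding \<open>e\<close>, neither in the configuration nor in its dual.

  If they are joined by no path avoiding \<open>e\<close> at all, in either of the two, then they lie in distinct infinite
  clusters once \<open>e\<close> is closed. This has probability zero, by the counting argument of Gandolfi, Grimmett and Russo. So the
  paths exist in at least one of the two, which are equally likely to be the one.
\<close>

text \<open>The bond \<open>(False, i, j)\<close> is horizontal and \<open>(True, i, j)\<close> is vertical; both start at \<open>(i, j)\<close>.\<close>

type_synonym bond = "bool \<times> int \<times> int"
type_synonym config = "bond \<Rightarrow> bool"

fun src :: "bond \<Rightarrow> vertex" where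
  "src (v, i, j) = (i, j)"

fun tgt :: "bond \<Rightarrow> vertex" where
  "tgt (v, i, j) = (if v then (i, j + 1) else (i + 1, j))"

definition step :: "config \<Rightarrow> vertex \<Rightarrow> vertex \<Rightarrow> bool" where
  "step c p q \<longleftrightarrow> (\<exists>e. c e \<and> (p = src e \<and> q = tgt e \<or> p = tgt e \<and> q = src e))"

abbreviation conn :: "config \<Rightarrow> vertex \<Rightarrow> vertex \<Rightarrow> bool" where
  "conn c \<equiv> (step c)\<^sup>*\<^sup>*"

abbreviation central_bond :: bond where
  "central_bond \<equiv> (False, 0, 0)"

abbreviation without_central :: "config \<Rightarrow> config" where
  "without_central c \<equiv> c(central_bond := False)"

text \<open>A dual bond is open iff the bond that it crosses is closed. The dual lattice is rotated by a
  quarter turn, such that the central bond is its own dual.\<close>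

fun dual :: "config \<Rightarrow> config" where
  "dual c (v, i, j) = (\<not> c (v, if v then j + 1 else j, - i))"

definition constant_on_clusters :: "config \<Rightarrow> (vertex \<Rightarrow> real) \<Rightarrow> bool" where
  "constant_on_clusters c h \<longleftrightarrow> (\<forall>e. c e \<longrightarrow> h (src e) = h (tgt e))"

lemma step_sym: "step c p q \<Longrightarrow> step c q p"
  unfolding step_def by blast

lemma conn_sym: "conn c p q \<Longrightarrow> conn c q p"
  by (induction rule: rtranclp_induct)
     (auto intro: converse_rtranclp_into_rtranclp step_sym)

lemma step_bond: "c e \<Longrightarrow> step c (src e) (tgt e)"
  unfolding step_def by blast

lemma conn_mono: "conn c p q \<Longrightarrow> (\<And>e. c e \<Longrightarrow> c' e) \<Longrightarrow> conn c' p q"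
  by (rule rtranclp_mono[THEN predicate2D, of "step c"]) (unfold step_def, blast+)

lemma constant_on_clusters_conn:
  assumes "constant_on_clusters c h" "conn c p q"
  shows "h p = h q"
  using assms(2)
  by (induction rule: rtranclp_induct)
     (use assms(1) in \<open>auto simp: step_def constant_on_clusters_def\<close>)

lemma constant_on_clusters_indicator:
  "constant_on_clusters c (indicator {q. conn c p q})"
  unfolding constant_on_clusters_def
proof (intro allI impI)
  fix e assume "c e"
  then have "conn c p (src e) \<longleftrightarrow> conn c p (tgt e)"
    by (meson rtranclp.rtrancl_into_rtrancl step_bond step_sym)
  then show "indicator {q. conn c p q} (src e) = (indicator {q. conn c p q} (tgt e) :: real)"
    by (simp add: indicator_def)
qed

section \<open>Duality on the torus\<close>

lemma sum_int_telescope: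
  fixes f :: "int \<Rightarrow> 'a::ab_group_add"
  assumes "a \<le> b"
  shows "(\<Sum>i\<in>{a..<b}. f (i + 1) - f i) = f b - f a"
  using assms
proof (induction b rule: int_ge_induct)
  case (step b)
  then have "{a..<b + 1} = insert b {a..<b}" by auto
  then show ?case using step by simp
qed simp

text \<open>Summation by parts, a discrete Stokes theorem. Up to sign, each term multiplies the
  increment of \<open>h\<close> along a bond by the increment of \<open>k\<close> along the dual
  bond crossing it. The coefficient of an interior value of \<open>h\<close> is a sum of increments
  of \<open>k\<close> around a dual face, which is zero, so only the boundary of the rectangle
  remains.\<close>

lemma pairing_eq_boundary:
  fixes h k :: "vertex \<Rightarrow> real"
  assumes "a \<le> b" "s \<le> t"
  defines "U \<equiv> \<lambda>i j. h (i, j) * (k (- j, i - 1) - k (1 - j, i - 1))"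
    and "V \<equiv> \<lambda>i j. h (i, j) * (k (1 - j, i) - k (1 - j, i - 1))"
  shows "(\<Sum>i\<in>{a..<b}. \<Sum>j\<in>{s..<t}.
            (h (i + 1, j) - h (i, j)) * (k (- j, i) - k (1 - j, i))
            - (h (i, j + 1) - h (i, j)) * (k (- j, i) - k (- j, i - 1)))
        = (\<Sum>j\<in>{s..<t}. U b j - U a j) - (\<Sum>i\<in>{a..<b}. V i t - V i s)"
proof -
  have "(\<Sum>i\<in>{a..<b}. \<Sum>j\<in>{s..<t}.
            (h (i + 1, j) - h (i, j)) * (k (- j, i) - k (1 - j, i))
            - (h (i, j + 1) - h (i, j)) * (k (- j, i) - k (- j, i - 1)))
        = (\<Sum>i\<in>{a..<b}. \<Sum>j\<in>{s..<t}. (U (i + 1) j - U i j) - (V i (j + 1) - V i j))"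
    unfolding U_def V_def by (intro sum.cong) (auto simp: algebra_simps)
  also have "\<dots> = (\<Sum>j\<in>{s..<t}. \<Sum>i\<in>{a..<b}. U (i + 1) j - U i j)
                - (\<Sum>i\<in>{a..<b}. \<Sum>j\<in>{s..<t}. V i (j + 1) - V i j)"
    by (subst sum.swap) (simp add: sum_subtractf)
  also have "\<dots> = (\<Sum>j\<in>{s..<t}. U b j - U a j) - (\<Sum>i\<in>{a..<b}. V i t - V i s)"
    by (simp only: sum_int_telescope[OF assms(1), of "\<lambda>i. U i _"]
        sum_int_telescope[OF assms(2), of "\<lambda>j. V _ j"])
  finally show ?thesis .
qed

text \<open>One of the two increments vanishes if the bond or the dual bond crossing it is open. A
  separate \<open>d\<close> in place of \<open>dual c\<close> allows both configurations to be
  modified at the central bond.\<close>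

lemma pairing_horizontal:
  assumes "constant_on_clusters c h" "constant_on_clusters d k"
    and "c (False, i, j) \<or> d (False, - j, i)"
  shows "(h (i + 1, j) - h (i, j)) * (k (- j, i) - k (1 - j, i)) = 0"
  using assms(3)
proof
  assume "c (False, i, j)"
  then have "h (src (False, i, j)) = h (tgt (False, i, j))"
    using assms(1) unfolding constant_on_clusters_def by blast
  then show ?thesis by simp
next
  assume "d (False, - j, i)"
  then have "k (src (False, - j, i)) = k (tgt (False, - j, i))"
    using assms(2) unfolding constant_on_clusters_def by blast
  then show ?thesis by simp
qed

lemma pairing_vertical:
  assumes "constant_on_clusters c h" "constant_on_clusters d k"
    and "c (True, i, j) \<or> d (True, - j, i - 1)"
  shows "(h (i, j + 1) - h (i, j)) * (k (- j, i) - k (- j, i - 1)) = 0"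
  using assms(3)
proof
  assume "c (True, i, j)"
  then have "h (src (True, i, j)) = h (tgt (True, i, j))"
    using assms(1) unfolding constant_on_clusters_def by blast
  then show ?thesis by simp
next
  assume "d (True, - j, i - 1)"
  then have "k (src (True, - j, i - 1)) = k (tgt (True, - j, i - 1))"
    using assms(2) unfolding constant_on_clusters_def by blast
  then show ?thesis by simp
qed

text \<open>If neither connection exists, pairing the indicators of the cluster in \<open>c\<close> and of the cluster
  in \<open>dual c\<close> leaves only the term of the central bond, whereas a finite cluster makes
  the boundary terms vanish.\<close>

lemma infinite_cluster_if_not_connected:
  assumes p: "p = (0, 0) \<and> q = (1, 0) \<or> p = (1, 0) \<and> q = (0, 0)"
    and nc: "\<not> conn (without_central c) p q"
    and nd: "\<not> conn (without_central (dual c)) (0, 0) (1, 0)"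
  shows "infinite {z. conn (without_central c) p z}"
proof
  define S where "S = {z. conn (without_central c) p z}"
  define h :: "vertex \<Rightarrow> real" where "h = indicator S"
  define k :: "vertex \<Rightarrow> real" where
    "k = indicator {z. conn (without_central (dual c)) (0, 0) z}"
  have h: "constant_on_clusters (without_central c) h"
    and k: "constant_on_clusters (without_central (dual c)) k"
    unfolding h_def k_def S_def by (rule constant_on_clusters_indicator)+
  have h01: "h p = 1" "h q = 0" and k01: "k (0, 0) = 1" "k (1, 0) = 0"
    using nc nd by (auto simp: h_def k_def S_def)
  assume "finite {z. conn (without_central c) p z}"
  then have "finite ((\<lambda>z. max \<bar>fst z\<bar> \<bar>snd z\<bar>) ` S)" by (simp add: S_def)
  then obtain M where M: "\<And>z. z \<in> S \<Longrightarrow> max \<bar>fst z\<bar> \<bar>snd z\<bar> \<le> M"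
    by (meson finite_imageI bdd_above_def bdd_above_finite imageI)
  have M0: "M \<ge> 0" using M[of p] by (force simp: S_def)
  have out: "h (i, j) = 0" if "\<bar>i\<bar> > M \<or> \<bar>j\<bar> > M" for i j
    using M[of "(i, j)"] that by (auto simp: h_def indicator_def)
  \<comment> \<open>The first and the last coordinate of the boundary, \<open>- M - 1\<close> and
    \<open>M + 1\<close>, lie just outside the square containing \<open>S\<close>, so
    \<open>h\<close> kills all boundary terms.\<close>
  define I where "I = {- M - 1..<M + 1}"
  define T where "T = (\<lambda>i j. (h (i + 1, j) - h (i, j)) * (k (- j, i) - k (1 - j, i))
            - (h (i, j + 1) - h (i, j)) * (k (- j, i) - k (- j, i - 1)))"
  have zero: "(\<Sum>i\<in>I. \<Sum>j\<in>I. T i j) = 0"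
    unfolding T_def I_def using M0 by (subst pairing_eq_boundary) (auto simp: out)
  have T0: "T i j = 0" if "(i, j) \<noteq> (0, 0)" for i j
    using pairing_horizontal[OF h k, of i j] pairing_vertical[OF h k, of i j] that
    by (auto simp: T_def)
  have "(\<Sum>i\<in>I. \<Sum>j\<in>I. T i j) = (\<Sum>i\<in>I. if i = 0 then T 0 0 else 0)"
  proof (intro sum.cong refl)
    fix i
    have "(\<Sum>j\<in>I. T i j) = (\<Sum>j\<in>I. if j = 0 then T i 0 else 0)"
      by (intro sum.cong) (auto simp: T0)
    then show "(\<Sum>j\<in>I. T i j) = (if i = 0 then T 0 0 else 0)"
      using M0 by (auto simp: I_def T0)
  qed
  also have "\<dots> = T 0 0"
    using M0 by (simp add: I_def)
  \<comment> \<open>Across the central bond, which is its own dual, \<open>k\<close> drops from 1 to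
    0. The vertical bond at the origin or its dual is open, so its term is zero.\<close>
  also have "\<dots> = h (1, 0) - h (0, 0)"
    using pairing_vertical[OF h k, of 0 0] k01 by (simp add: T_def)
  finally have "h (1, 0) = h (0, 0)"
    using zero by simp
  then show False using p h01 by auto
qed

section \<open>Periods and windings on the torus\<close>

definition periodic :: "int \<Rightarrow> config \<Rightarrow> bool" where
  "periodic N c \<longleftrightarrow> (\<forall>v i j s t. c (v, i + N * s, j + N * t) = c (v, i, j))"

text \<open>For periodic \<open>c\<close>, these are the first cohomology classes of the torus that
  vanish on the open clusters. Real coefficients make them a linear subspace of the plane, which has
  an orthogonal complement.\<close>

definition periods :: "int \<Rightarrow> config \<Rightarrow> (real \<times> real) set" where
  "periods N c = {(a, b). \<exists>h. constant_on_clusters c h \<and>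
     (\<forall>i j s t. h (i + N * s, j + N * t) = h (i, j) + s * a + t * b)}"

text \<open>The counterpart in homology: the displacements, in units of \<open>N\<close>, of open
  walks that close up on the torus.\<close>

definition windings :: "int \<Rightarrow> config \<Rightarrow> (int \<times> int) set" where
  "windings N c = {(s, t). \<exists>i j. conn c (i, j) (i + N * s, j + N * t)}"

lemma periodic_dual: "periodic N c \<Longrightarrow> periodic N (dual c)"
  unfolding periodic_def
proof (intro allI)
  fix v i j s t
  assume "\<forall>v i j s t. c (v, i + N * s, j + N * t) = c (v, i, j)"
  then have "c (v, (if v then j + 1 else j) + N * t, - i + N * (- s)) = c (v, if v then j + 1 else j, - i)"
    by blast
  then show "dual c (v, i + N * s, j + N * t) = dual c (v, i, j)"
    by (cases v) (simp_all add: algebra_simps)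
qed

lemma periods_add:
  assumes "(a, b) \<in> periods N c" "(a', b') \<in> periods N c"
  shows "(a + a', b + b') \<in> periods N c"
proof -
  from assms obtain h h' where "constant_on_clusters c h" "constant_on_clusters c h'"
    "\<forall>i j s t. h (i + N * s, j + N * t) = h (i, j) + s * a + t * b"
    "\<forall>i j s t. h' (i + N * s, j + N * t) = h' (i, j) + s * a' + t * b'"
    by (auto simp: periods_def)
  then show ?thesis
    unfolding periods_def
    by (intro CollectI case_prodI exI[of _ "\<lambda>p. h p + h' p"])
       (auto simp: constant_on_clusters_def algebra_simps)
qed

lemma periods_scale:
  assumes "(a, b) \<in> periods N c"
  shows "(r * a, r * b) \<in> periods N c"
proof -
  from assms obtain h where "constant_on_clusters c h"
    "\<forall>i j s t. h (i + N * s, j + N * t) = h (i, j) + s * a + t * b"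
    by (auto simp: periods_def)
  then show ?thesis
    unfolding periods_def
    by (intro CollectI case_prodI exI[of _ "\<lambda>p. r * h p"])
       (auto simp: constant_on_clusters_def algebra_simps)
qed

text \<open>Sum by parts over a fundamental domain. Every bond or the dual bond crossing it is open,
  so the pairing is zero. On opposite sides \<open>h\<close> differs by one of its periods, and the
  increments of \<open>k\<close> that remain telescope to the periods of \<open>k\<close>.\<close>

lemma periods_dual_orthogonal:
  assumes N: "N > 0" and a: "(a1, a2) \<in> periods N c" and b: "(b1, b2) \<in> periods N (dual c)"
  shows "a1 * b1 + a2 * b2 = 0"
proof -
  obtain h where h: "constant_on_clusters c h"
    and hp: "\<And>i j s t. h (i + N * s, j + N * t) = h (i, j) + s * a1 + t * a2"
    using a by (auto simp: periods_def)
  obtain k where k: "constant_on_clusters (dual c) k"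
    and kp: "\<And>i j s t. k (i + N * s, j + N * t) = k (i, j) + s * b1 + t * b2"
    using b by (auto simp: periods_def)
  define U where "U = (\<lambda>i j. h (i, j) * (k (- j, i - 1) - k (1 - j, i - 1)))"
  define V where "V = (\<lambda>i j. h (i, j) * (k (1 - j, i) - k (1 - j, i - 1)))"
  have kN: "k (i, N - 1) = k (i, - 1) + b2" for i
    using kp[of i 0 "- 1" 1] by simp
  have "U N j - U 0 j = a1 * (k (1 - (j + 1), - 1) - k (1 - j, - 1))" for j
    using hp[of 0 1 j 0] by (simp add: U_def kN algebra_simps)
  then have "(\<Sum>j\<in>{0..<N}. U N j - U 0 j) = a1 * (\<Sum>j\<in>{0..<N}. k (1 - (j + 1), - 1) - k (1 - j, - 1))"
    by (simp add: sum_distrib_left)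
  also have "\<dots> = a1 * (k (1 - N, - 1) - k (1 - 0, - 1))"
    using N by (subst sum_int_telescope) auto
  also have "\<dots> = - (a1 * b1)"
    using kp[of "1 - N" 1 "- 1" 0] by (simp add: algebra_simps)
  finally have 1: "(\<Sum>j\<in>{0..<N}. U N j - U 0 j) = - (a1 * b1)" .
  have k1: "k (1 - N, i) = k (1, i) - b1" for i
    using kp[of "1 - N" 1 i 0] by simp
  have "V i N - V i 0 = a2 * (k (1, (i + 1) - 1) - k (1, i - 1))" for i
    using hp[of i 0 0 1] by (simp add: V_def k1 algebra_simps)
  then have "(\<Sum>i\<in>{0..<N}. V i N - V i 0) = a2 * (\<Sum>i\<in>{0..<N}. k (1, (i + 1) - 1) - k (1, i - 1))"
    by (simp add: sum_distrib_left)
  also have "\<dots> = a2 * (k (1, N - 1) - k (1, 0 - 1))"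
    using N by (subst sum_int_telescope) auto
  also have "\<dots> = a2 * b2" by (simp add: kN)
  finally have 2: "(\<Sum>i\<in>{0..<N}. V i N - V i 0) = a2 * b2" .
  have "c (False, i, j) \<or> dual c (False, - j, i)" "c (True, i, j) \<or> dual c (True, - j, i - 1)" for i j
    by auto
  then have "(\<Sum>i\<in>{0..<N}. \<Sum>j\<in>{0..<N}.
            (h (i + 1, j) - h (i, j)) * (k (- j, i) - k (1 - j, i))
            - (h (i, j + 1) - h (i, j)) * (k (- j, i) - k (- j, i - 1))) = 0"
    by (simp add: pairing_horizontal[OF h k] pairing_vertical[OF h k])
  then show ?thesis
    using pairing_eq_boundary[of 0 N 0 N h k] N 1 2 unfolding U_def V_def by simp
qed

lemma conn_shift:
  assumes "periodic N c" "conn c p q"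
  shows "conn c (fst p + N * s, snd p + N * t) (fst q + N * s, snd q + N * t)"
  using assms(2)
proof (induction rule: rtranclp_induct)
  case (step q r)
  from step.hyps(2) obtain e where e: "c e" "q = src e \<and> r = tgt e \<or> q = tgt e \<and> r = src e"
    unfolding step_def by blast
  obtain v i j where vij: "e = (v, i, j)" by (cases e)
  have "c (v, i + N * s, j + N * t)"
    using assms(1) e(1) vij by (simp add: periodic_def)
  from step_bond[of c, OF this] step_sym[OF step_bond[of c, OF this]]
  have "step c (fst q + N * s, snd q + N * t) (fst r + N * s, snd r + N * t)"
    using e(2) vij by (cases v) (auto simp: algebra_simps)
  then show ?case using step.IH by auto
qed simp

text \<open>Pick a representative of every class of vertices that are connected up to translation by
  multiples of \<open>N\<close>. A vertex joined to the translate of its representative by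
  \<open>(s, t)\<close> receives the value \<open>a * s + b * t\<close>. Two choices of
  \<open>(s, t)\<close> differ by a winding, so orthogonality makes the value well defined.\<close>

lemma orthogonal_windings_subset_periods:
  assumes per: "periodic N c"
    and orth: "\<And>s t. (s, t) \<in> windings N c \<Longrightarrow> a * s + b * t = 0"
  shows "(a, b) \<in> periods N c"
proof -
  define R where "R = (\<lambda>p q. \<exists>s t. conn c p (fst q + N * s, snd q + N * t))"
  have R_refl: "R p p" for p
    unfolding R_def by (rule exI[of _ 0], rule exI[of _ 0]) simp
  have R_sym: "R q p" if "R p q" for p q
  proof -
    from that obtain s t where "conn c p (fst q + N * s, snd q + N * t)" unfolding R_def by blast
    from conn_shift[OF per conn_sym[OF this], of "- s" "- t"]
    show ?thesis unfolding R_def by (intro exI[of _ "- s"] exI[of _ "- t"]) simp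
  qed
  have R_trans: "R p r" if pq: "R p q" and qr: "R q r" for p q r
  proof -
    from pq obtain s t where 1: "conn c p (fst q + N * s, snd q + N * t)" unfolding R_def by blast
    from qr obtain s' t' where "conn c q (fst r + N * s', snd r + N * t')" unfolding R_def by blast
    from rtranclp_trans[OF 1 conn_shift[OF per this, of s t]]
    show ?thesis unfolding R_def
      by (intro exI[of _ "s + s'"] exI[of _ "t + t'"]) (simp add: algebra_simps)
  qed
  define rep where "rep = (\<lambda>p. SOME q. R p q)"
  have R_rep: "R p (rep p)" for p
    unfolding rep_def by (rule someI_ex) (use R_refl in blast)
  have rep_eq: "rep p = rep q" if "R p q" for p q
  proof -
    have "R p = R q" using R_trans[OF that] R_trans[OF R_sym[OF that]] by blast
    then show ?thesis by (simp add: rep_def)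
  qed
  define pos where "pos = (\<lambda>p s t. conn c p (fst (rep p) + N * s, snd (rep p) + N * t))"
  have pos_ex: "\<exists>s t. pos p s t" for p
    using R_rep[of p] unfolding pos_def R_def .
  then obtain u v where uv: "\<And>p. pos p (u p) (v p)" by metis
  define h where "h = (\<lambda>p. a * u p + b * v p)"
  have h_eq: "h p = a * s + b * t" if st: "pos p s t" for p s t
  proof -
    from st uv[of p] have "conn c (fst (rep p) + N * s, snd (rep p) + N * t)
        (fst (rep p) + N * u p, snd (rep p) + N * v p)"
      unfolding pos_def by (rule rtranclp_trans[OF conn_sym])
    then have "(u p - s, v p - t) \<in> windings N c"
      unfolding windings_def
      by (intro CollectI case_prodI exI[of _ "fst (rep p) + N * s"] exI[of _ "snd (rep p) + N * t"])
         (simp add: algebra_simps)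
    from orth[OF this] show ?thesis
      by (simp add: h_def algebra_simps)
  qed
  have "h (i + N * s, j + N * t) = h (i, j) + s * a + t * b" for i j s t
  proof -
    obtain s' t' where st: "pos (i, j) s' t'" using pos_ex by blast
    have "R (i + N * s, j + N * t) (i, j)"
      unfolding R_def by (intro exI[of _ s] exI[of _ t]) simp
    then have "rep (i + N * s, j + N * t) = rep (i, j)" by (rule rep_eq)
    then have "pos (i + N * s, j + N * t) (s' + s) (t' + t)"
      using conn_shift[OF per st[unfolded pos_def], of s t]
      by (simp add: pos_def algebra_simps)
    from h_eq[OF this] h_eq[OF st] show ?thesis by (simp add: algebra_simps)
  qed
  moreover have "constant_on_clusters c h"
    unfolding constant_on_clusters_def
  proof (intro allI impI)
    fix e assume "c e"
    then have e: "conn c (src e) (tgt e)" by (blast intro: step_bond)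
    obtain s t where st: "pos (tgt e) s t" using pos_ex by blast
    have "R (src e) (tgt e)"
      unfolding R_def using e by (intro exI[of _ 0]) simp
    then have "rep (src e) = rep (tgt e)" by (rule rep_eq)
    then have "pos (src e) s t"
      using st e by (auto simp: pos_def)
    from h_eq[OF this] h_eq[OF st] show "h (src e) = h (tgt e)" by simp
  qed
  ultimately show ?thesis unfolding periods_def by blast
qed

lemma exists_antidifference:
  "\<exists>G :: int \<Rightarrow> real. G 0 = 0 \<and> (\<forall>n. G n - G (n - 1) = f n)"
proof -
  \<comment> \<open>For every \<open>n\<close> at most one of the two sums is nonempty; the second
    one integrates in the negative direction.\<close>
  define G where "G = (\<lambda>n. (\<Sum>i\<in>{0<..n}. f i) - (\<Sum>i\<in>{n<..0}. f i))"
  have "G n - G (n - 1) = f n" for n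
  proof (cases "n > 0")
    case True
    then have "{0<..n} = insert n {0<..n - 1}" "{n<..0} = {}" "{n - 1<..0} = {}" by auto
    then show ?thesis by (simp add: G_def)
  next
    case False
    then have "{n - 1<..0} = insert n {n<..0}" "{0<..n} = {}" "{0<..n - 1} = {}" by auto
    then show ?thesis by (simp add: G_def)
  qed
  then show ?thesis by (intro exI[of _ G]) (simp add: G_def)
qed

lemma int_shift_eq:
  fixes f :: "int \<Rightarrow> real"
  assumes "\<And>n. f (n + N) = f n + a"
  shows "f (n + N * u) = f n + u * a"
proof (induction u rule: int_induct[where k = 0])
  case (step1 i)
  then show ?case using assms[of "n + N * i"] by (simp add: algebra_simps)
next
  case (step2 i)
  then show ?case using assms[of "n + N * (i - 1)"] by (simp add: algebra_simps)
qed simp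

lemma int_constant:
  fixes f :: "int \<Rightarrow> real"
  assumes "\<And>n. f n = f (n - 1)"
  shows "f m = f n"
  using int_shift_eq[of f 1 0 n "m - n"] assms by (metis add.commute add_diff_cancel_right' diff_add_cancel mult_1 mult_zero_right add_0_right)

text \<open>A discrete Poincare lemma: \<open>G\<close> is the stream function of a divergence-free
  flow. Integrate \<open>Y\<close> along row 0 and then \<open>- X\<close> along each column. By the
  divergence condition the error \<open>E\<close> in the other equation is constant along columns,
  and it is zero in row 0.\<close>

lemma exists_potential:
  fixes X Y :: "int \<Rightarrow> int \<Rightarrow> real"
  assumes div0: "\<And>i j. X i j - X (i - 1) j + Y i j - Y i (j - 1) = 0"
  obtains G where "\<And>i j. G i j - G i (j - 1) = - X i j" "\<And>i j. G i j - G (i - 1) j = Y i j"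
proof -
  obtain A where A: "\<And>n. A n - A (n - 1) = Y n 0"
    using exists_antidifference[of "\<lambda>n. Y n 0"] by blast
  have "\<forall>i. \<exists>B. B 0 = 0 \<and> (\<forall>n. B n - B (n - 1) = - X i n)"
    by (intro allI exists_antidifference)
  then obtain B where B: "\<And>i. B i 0 = 0" "\<And>i n. B i n - B i (n - 1) = - X i n"
    by metis
  define E where "E = (\<lambda>i j. A i + B i j - (A (i - 1) + B (i - 1) j) - Y i j)"
  have "E i j = E i (j - 1)" for i j
    using div0[of i j] B(2)[of i j] B(2)[of "i - 1" j] by (simp add: E_def)
  then have E_const: "E i j = E i 0" for i j by (rule int_constant[of "E i"])
  have E0: "E i j = 0" for i j
  proof -
    have "E i j = E i 0" by (rule E_const)
    also have "\<dots> = A i - A (i - 1) - Y i 0" by (simp add: E_def B(1))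
    also have "\<dots> = 0" by (simp only: A diff_self)
    finally show ?thesis .
  qed
  have "(A i + B i j) - (A (i - 1) + B (i - 1) j) = Y i j" for i j
    using E0[of i j] unfolding E_def by linarith
  moreover have "(A i + B i j) - (A i + B i (j - 1)) = - X i j" for i j
    using B(2)[of i j] by simp
  ultimately show thesis by (rule that[rotated])
qed

definition lattice_delta :: "int \<Rightarrow> vertex \<Rightarrow> int \<Rightarrow> int \<Rightarrow> real" where
  "lattice_delta N p i j = of_bool (N dvd i - fst p \<and> N dvd j - snd p)"

lemma sum_lattice_delta:
  assumes "N > 0"
  shows "(\<Sum>i\<in>{0..<N}. \<Sum>j\<in>{0..<N}. lattice_delta N p i j) = 1"
proof -
  have 1: "(\<Sum>i\<in>{0..<N}. of_bool (N dvd i - a) :: real) = 1" for a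
  proof -
    have "N dvd i - a \<longleftrightarrow> i = a mod N" if "i \<in> {0..<N}" for i
      using that by (auto simp: mod_eq_dvd_iff[symmetric])
    then have "(\<Sum>i\<in>{0..<N}. of_bool (N dvd i - a) :: real) = (\<Sum>i\<in>{0..<N}. if i = a mod N then 1 else 0)"
      by (intro sum.cong) auto
    then show ?thesis using assms by simp
  qed
  have "(\<Sum>i\<in>{0..<N}. \<Sum>j\<in>{0..<N}. lattice_delta N p i j)
      = (\<Sum>i\<in>{0..<N}. of_bool (N dvd i - fst p)) * (\<Sum>j\<in>{0..<N}. of_bool (N dvd j - snd p))"
    by (simp only: lattice_delta_def sum_product of_bool_conj)
  then show ?thesis by (simp only: 1 mult_1)
qed

text \<open>An open walk from \<open>p\<close> to \<open>q\<close> induces a flow on the torus with source \<open>p\<close> and sink \<open>q\<close> that is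
  carried by open bonds and whose total mass is the displacement of the walk.\<close>

lemma conn_imp_flow:
  assumes per: "periodic N c" and N: "N > 0" and pq: "conn c p q"
  shows "\<exists>X Y. (\<forall>i j s t. X (i + N * s) (j + N * t) = X i j) \<and> (\<forall>i j s t. Y (i + N * s) (j + N * t) = Y i j) \<and>
    (\<forall>i j. X i j \<noteq> 0 \<longrightarrow> c (False, i, j)) \<and> (\<forall>i j. Y i j \<noteq> 0 \<longrightarrow> c (True, i, j)) \<and>
    (\<forall>i j. X i j - X (i - 1) j + Y i j - Y i (j - 1) = lattice_delta N p i j - lattice_delta N q i j) \<and>
    (\<Sum>i\<in>{0..<N}. \<Sum>j\<in>{0..<N}. X i j) = of_int (fst q - fst p) \<and>
    (\<Sum>i\<in>{0..<N}. \<Sum>j\<in>{0..<N}. Y i j) = of_int (snd q - snd p)"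
  using pq
proof (induction rule: rtranclp_induct)
  case base
  show ?case by (intro exI[of _ "\<lambda>_ _. 0"]) simp
next
  case (step q r)
  from step.hyps(2) obtain v k l where e: "c (v, k, l)"
      "q = src (v, k, l) \<and> r = tgt (v, k, l) \<or> q = tgt (v, k, l) \<and> r = src (v, k, l)"
    unfolding step_def by (metis prod.exhaust)
  \<comment> \<open>The sign records whether the walk traverses the bond from \<open>src\<close> to
    \<open>tgt\<close> or backwards.\<close>
  define \<sigma> :: real where "\<sigma> = (if q = src (v, k, l) then 1 else - 1)"
  define \<delta> where "\<delta> = lattice_delta N (k, l)"
  have \<delta>_per: "\<delta> (i + N * s) (j + N * t) = \<delta> i j" for i j s t
  proof -
    have "i + N * s - k = i - k + N * s" "j + N * t - l = j - l + N * t" by simp_all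
    then show ?thesis
      unfolding \<delta>_def lattice_delta_def by (simp only: fst_conv snd_conv dvd_add_left_iff dvd_triv_left)
  qed
  have \<delta>_open: "c (v, i, j)" if "\<delta> i j \<noteq> 0" for i j
  proof -
    from that have "N dvd i - k" "N dvd j - l"
      by (auto simp: \<delta>_def lattice_delta_def)
    then obtain s t where "i - k = N * s" "j - l = N * t"
      unfolding dvd_def by blast
    then have "i = k + N * s" "j = l + N * t" by auto
    then show ?thesis using per e(1) by (simp add: periodic_def)
  qed
  have \<delta>_left: "lattice_delta N (k + 1, l) i j = \<delta> (i - 1) j"
    and \<delta>_below: "lattice_delta N (k, l + 1) i j = \<delta> i (j - 1)" for i j
    by (simp_all add: \<delta>_def lattice_delta_def algebra_simps)
  from step.IH obtain X Y where XY:
    "\<And>i j s t. X (i + N * s) (j + N * t) = X i j" "\<And>i j s t. Y (i + N * s) (j + N * t) = Y i j"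
    "\<And>i j. X i j \<noteq> 0 \<Longrightarrow> c (False, i, j)" "\<And>i j. Y i j \<noteq> 0 \<Longrightarrow> c (True, i, j)"
    "\<And>i j. X i j - X (i - 1) j + Y i j - Y i (j - 1) = lattice_delta N p i j - lattice_delta N q i j"
    "(\<Sum>i\<in>{0..<N}. \<Sum>j\<in>{0..<N}. X i j) = of_int (fst q - fst p)"
    "(\<Sum>i\<in>{0..<N}. \<Sum>j\<in>{0..<N}. Y i j) = of_int (snd q - snd p)"
    by blast
  define X' where "X' = (\<lambda>i j. if v then X i j else X i j + \<sigma> * \<delta> i j)"
  define Y' where "Y' = (\<lambda>i j. if v then Y i j + \<sigma> * \<delta> i j else Y i j)"
  have "X' (i + N * s) (j + N * t) = X' i j" "Y' (i + N * s) (j + N * t) = Y' i j" for i j s t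
    by (simp_all add: X'_def Y'_def XY(1,2) \<delta>_per)
  have "X' i j \<noteq> 0 \<longrightarrow> c (False, i, j)" "Y' i j \<noteq> 0 \<longrightarrow> c (True, i, j)" for i j
    using XY(3,4)[of i j] \<delta>_open[of i j]
    by (cases "\<delta> i j = 0"; cases v; simp add: X'_def Y'_def)+
  have "X' i j - X' (i - 1) j + Y' i j - Y' i (j - 1) = lattice_delta N p i j - lattice_delta N r i j" for i j
    using XY(5)[of i j] e(2) \<delta>_left[of i j] \<delta>_below[of i j]
    by (cases v) (auto simp: X'_def Y'_def \<sigma>_def \<delta>_def[symmetric] algebra_simps)
  have "(\<Sum>i\<in>{0..<N}. \<Sum>j\<in>{0..<N}. \<sigma> * \<delta> i j) = \<sigma>"
    using sum_lattice_delta[OF N, of "(k, l)"] by (simp add: \<delta>_def sum_distrib_left[symmetric])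
  then have "(\<Sum>i\<in>{0..<N}. \<Sum>j\<in>{0..<N}. X' i j) = of_int (fst r - fst p)"
     "(\<Sum>i\<in>{0..<N}. \<Sum>j\<in>{0..<N}. Y' i j) = of_int (snd r - snd p)"
    using XY(6,7) e(2)
    by (cases v; auto simp: X'_def Y'_def sum.distrib \<sigma>_def)+
  show ?case
    by (rule exI[of _ X'], rule exI[of _ Y'], intro conjI allI) fact+
qed

text \<open>A walk closing up on the torus carries a divergence-free flow. Its stream function
  changes only across bonds with flow, which are open, so on the dual lattice it is constant on the
  clusters of \<open>dual c\<close>. Up to sign, its periods are the total flow divided by
  \<open>N\<close>.\<close>

lemma windings_subset_periods_dual:
  assumes per: "periodic N c" and N: "N > 0" and w: "(w1, w2) \<in> windings N c"
  shows "(of_int w1, of_int w2) \<in> periods N (dual c)"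
proof -
  from w obtain i0 j0 where "conn c (i0, j0) (i0 + N * w1, j0 + N * w2)"
    by (auto simp: windings_def)
  from conn_imp_flow[OF per N this] obtain X Y where XY:
    "\<And>i j s t. X (i + N * s) (j + N * t) = X i j" "\<And>i j s t. Y (i + N * s) (j + N * t) = Y i j"
    "\<And>i j. X i j \<noteq> 0 \<Longrightarrow> c (False, i, j)" "\<And>i j. Y i j \<noteq> 0 \<Longrightarrow> c (True, i, j)"
    "\<And>i j. X i j - X (i - 1) j + Y i j - Y i (j - 1)
       = lattice_delta N (i0, j0) i j - lattice_delta N (i0 + N * w1, j0 + N * w2) i j"
    "(\<Sum>i\<in>{0..<N}. \<Sum>j\<in>{0..<N}. X i j) = of_int (N * w1)"
    "(\<Sum>i\<in>{0..<N}. \<Sum>j\<in>{0..<N}. Y i j) = of_int (N * w2)"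
    by (simp only: fst_conv snd_conv add_diff_cancel_left') blast
  have "i - (i0 + N * w1) = i - i0 + N * (- w1)" "j - (j0 + N * w2) = j - j0 + N * (- w2)" for i j
    by simp_all
  then have "lattice_delta N (i0 + N * w1, j0 + N * w2) i j = lattice_delta N (i0, j0) i j" for i j
    unfolding lattice_delta_def by (simp only: fst_conv snd_conv dvd_add_left_iff dvd_triv_left)
  then obtain G where G: "\<And>i j. G i j - G i (j - 1) = - X i j" "\<And>i j. G i j - G (i - 1) j = Y i j"
    using exists_potential[of X Y] XY(5) by auto
  have X1: "X (i + N) j = X i j" "X i (j + N) = X i j" "Y (i + N) j = Y i j" "Y i (j + N) = Y i j" for i j
    using XY(1)[of i 1 j 0] XY(1)[of i 0 j 1] XY(2)[of i 1 j 0] XY(2)[of i 0 j 1] by auto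
  \<comment> \<open>The increments of \<open>G\<close> over a full period do not depend on the
    position, because the flow is periodic.\<close>
  define P where "P = (\<lambda>i j. G i (j + N) - G i j)"
  define Q where "Q = (\<lambda>i j. G (i + N) j - G i j)"
  have "P i j = P i (j - 1)" "P i j = P (i - 1) j" "Q i j = Q i (j - 1)" "Q i j = Q (i - 1) j" for i j
    using G(1)[of i j] G(2)[of i j] G(1)[of i "j + N"] G(2)[of i "j + N"]
      G(1)[of "i + N" j] G(2)[of "i + N" j] X1[of i j]
    by (simp_all add: P_def Q_def algebra_simps)
  then have PQ: "P i j = P k l" "Q i j = Q k l" for i j k l
    by (metis int_constant[of "\<lambda>i. P i _"] int_constant[of "\<lambda>j. P _ j"],
        metis int_constant[of "\<lambda>i. Q i _"] int_constant[of "\<lambda>j. Q _ j"])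
  have "(\<Sum>j\<in>{0..<N}. - X i j) = P i (- 1)" for i
    using sum_int_telescope[of 0 N "\<lambda>j. G i (j - 1)"] N by (simp add: G(1) P_def)
  then have "(\<Sum>i\<in>{0..<N}. \<Sum>j\<in>{0..<N}. - X i j) = (\<Sum>i\<in>{0..<N}. P 0 0)"
    by (simp only:) (intro sum.cong refl PQ)
  then have "real_of_int N * (P 0 0 + w1) = 0"
    using N XY(6) by (simp add: sum_negf algebra_simps)
  then have P: "P 0 0 = - w1" using N by simp
  have "(\<Sum>i\<in>{0..<N}. Y i j) = Q (- 1) j" for j
    using sum_int_telescope[of 0 N "\<lambda>i. G (i - 1) j"] N by (simp add: G(2) Q_def)
  then have "(\<Sum>j\<in>{0..<N}. \<Sum>i\<in>{0..<N}. Y i j) = (\<Sum>j\<in>{0..<N}. Q 0 0)"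
    by (simp only:) (intro sum.cong refl PQ)
  then have "real_of_int N * (Q 0 0 - w2) = 0"
    using N XY(7) by (subst (asm) sum.swap) (simp add: algebra_simps)
  then have Q: "Q 0 0 = w2" using N by simp
  \<comment> \<open>The quarter turn matches the convention of \<open>dual\<close> and turns the
    increment \<open>- w1\<close> of \<open>G\<close> in its second argument into the period
    \<open>w1\<close>.\<close>
  define k where "k = (\<lambda>(i, j). G j (- i))"
  have "k (i + N, j) = k (i, j) + w1" for i j
    using PQ(1)[of j "- i - N" 0 0] P by (simp add: k_def P_def)
  then have k1: "k (i + N * s, j) = k (i, j) + of_int s * of_int w1" for i j s
    by (rule int_shift_eq[of "\<lambda>i. k (i, j)"])
  have "k (i, j + N) = k (i, j) + w2" for i j
    using PQ(2)[of j "- i" 0 0] Q by (simp add: k_def Q_def)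
  then have k2: "k (i, j + N * t) = k (i, j) + of_int t * of_int w2" for i j t
    by (rule int_shift_eq[of "\<lambda>j. k (i, j)"])
  have "constant_on_clusters (dual c) k"
    unfolding constant_on_clusters_def
  proof (intro allI impI)
    fix e assume e: "dual c e"
    obtain v i j where vij: "e = (v, i, j)" by (cases e)
    show "k (src e) = k (tgt e)"
    proof (cases v)
      case True
      then have "Y (j + 1) (- i) = 0" using e vij XY(4) by fastforce
      then show ?thesis using G(2)[of "j + 1" "- i"] True by (simp add: k_def vij)
    next
      case False
      then have "X j (- i) = 0" using e vij XY(3) by fastforce
      then show ?thesis using G(1)[of j "- i"] False by (simp add: k_def vij)
    qed
  qed
  then show ?thesis
    unfolding periods_def by (intro CollectI case_prodI exI[of _ k]) (simp add: k1 k2)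
qed

text \<open>For the harder inclusion, the real span of the windings consists of periods of the dual.
  It is the whole plane, or a line, or zero. On a line through \<open>(s, t)\<close> the vector
  \<open>(- t, s)\<close> is a period of \<open>c\<close>, which forces \<open>b\<close> onto that
  line; if all windings are zero, \<open>b\<close> itself is a period of \<open>c\<close> and thus
  orthogonal to itself.\<close>

lemma periods_dual:
  assumes per: "periodic N c" and N: "N > 0"
  shows "periods N (dual c) = {(b1, b2). \<forall>(a1, a2) \<in> periods N c. a1 * b1 + a2 * b2 = 0}"
    (is "?L = ?R")
proof
  show "?L \<subseteq> ?R"
    using periods_dual_orthogonal[OF N] by auto
next
  show "?R \<subseteq> ?L"
  proof
    fix b assume "b \<in> ?R"
    moreover obtain b1 b2 where b_eq: "b = (b1, b2)" by (cases b)
    ultimately have b: "\<And>a1 a2. (a1, a2) \<in> periods N c \<Longrightarrow> a1 * b1 + a2 * b2 = 0" by auto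
    have in_dual: "(r * of_int s, r * of_int t) \<in> ?L" if "(s, t) \<in> windings N c" for r s t
      by (rule periods_scale[OF windings_subset_periods_dual[OF per N that]])
    show "b \<in> ?L"
    proof (cases "\<exists>s t s' t'. (s, t) \<in> windings N c \<and> (s', t') \<in> windings N c \<and> s * t' - t * s' \<noteq> 0")
      case True
      then obtain s t s' t' where st: "(s, t) \<in> windings N c" "(s', t') \<in> windings N c"
        and det: "s * t' - t * s' \<noteq> 0" by blast
      define d where "d = real_of_int (s * t' - t * s')"
      have d: "d \<noteq> 0" unfolding d_def of_int_eq_0_iff by (rule det)
      \<comment> \<open>Cramer's rule for writing \<open>(b1, b2)\<close> as a combination of two
        independent windings.\<close>
      define r r' where "r = (b1 * t' - b2 * s') / d" and "r' = (b2 * s - b1 * t) / d"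
      have "r * s + r' * s' = b1 * d / d" "r * t + r' * t' = b2 * d / d"
        unfolding r_def r'_def by (simp_all add: d_def add_divide_distrib[symmetric] algebra_simps)
      then have "r * s + r' * s' = b1" "r * t + r' * t' = b2" using d by simp_all
      then show ?thesis
        using periods_add[OF in_dual[OF st(1), of r] in_dual[OF st(2), of r']] b_eq by simp
    next
      case parallel: False
      obtain s t where st: "(s, t) \<in> windings N c"
        and st0: "(\<exists>w \<in> windings N c. w \<noteq> (0, 0)) \<longrightarrow> (s, t) \<noteq> (0, 0)"
      proof (cases "\<exists>w \<in> windings N c. w \<noteq> (0, 0)")
        case True
        then show ?thesis using that by fastforce
      next
        case False
        have "(0, 0) \<in> windings N c" by (simp add: windings_def)
        then show ?thesis using that False by blast
      qed
      show ?thesis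
      proof (cases "(s, t) = (0, 0)")
        case True
        then have "\<And>s t. (s, t) \<in> windings N c \<Longrightarrow> s = 0 \<and> t = 0" using st0 by blast
        then have "(b1, b2) \<in> periods N c"
          using orthogonal_windings_subset_periods[OF per] by (metis add.right_neutral mult_zero_right of_int_0)
        then have "b1 * b1 + b2 * b2 = 0" by (rule b)
        then have "b = (0, 0)" using b_eq sum_squares_eq_zero_iff[of b1 b2] by auto
        then show ?thesis using in_dual[OF st, of 0] by simp
      next
        case False
        have "(- real_of_int t, real_of_int s) \<in> periods N c"
        proof (rule orthogonal_windings_subset_periods[OF per])
          fix s' t' assume "(s', t') \<in> windings N c"
          then have "s * t' - t * s' = 0" using parallel st by blast
          then have "real_of_int (s * t' - t * s') = 0" by simp
          then show "- real_of_int t * s' + real_of_int s * t' = 0" by (simp add: algebra_simps)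
        qed
        from b[OF this] have bt: "b2 * s = b1 * t" by (simp add: algebra_simps)
        show ?thesis
        proof (cases "s = 0")
          case True
          then show ?thesis using in_dual[OF st, of "b2 / t"] bt False b_eq by simp
        next
          case s: False
          then have "b2 = b1 / s * t" using bt by (simp add: field_simps)
          then show ?thesis using in_dual[OF st, of "b1 / s"] s b_eq by simp
        qed
      qed
    qed
  qed
qed

text \<open>A subspace equal to its own orthogonal complement would consist of vectors orthogonal to
  themselves and hence be zero, but the complement of zero is the whole plane.\<close>

lemma periods_dual_neq:
  assumes "periodic N c" "N > 0"
  shows "periods N (dual c) \<noteq> periods N c"
proof
  assume eq: "periods N (dual c) = periods N c"
  note perp = periods_dual[OF assms, unfolded eq]
  have "(1, 0) \<notin> periods N c" using periods_dual_orthogonal[OF assms(2), of 1 0 c 1 0] eq by auto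
  then obtain a1 a2 where a: "(a1, a2) \<in> periods N c" "a1 \<noteq> 0"
    by (subst (asm) perp) auto
  then have "a1 * a1 + a2 * a2 = 0"
    using periods_dual_orthogonal[OF assms(2), of a1 a2 c a1 a2] eq by auto
  then show False using a(2) sum_squares_eq_zero_iff[of a1 a2] by auto
qed

text \<open>Opening translates of the central bond adds no constraint: a function constant on the
  clusters of \<open>c\<close> already agrees at the two ends of the central bond, and by additivity
  at the two ends of each translate.\<close>

lemma periods_eq_if_connected:
  assumes conn: "conn c (0, 0) (1, 0)"
    and mono: "\<And>e. c e \<Longrightarrow> c' e"
    and only: "\<And>e. c' e \<Longrightarrow> \<not> c e \<Longrightarrow> \<exists>s t. e = (False, N * s, N * t)"
  shows "periods N c' = periods N c"
proof
  show "periods N c' \<subseteq> periods N c"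
    using mono unfolding periods_def constant_on_clusters_def by blast
next
  have "constant_on_clusters c' h"
    if h: "constant_on_clusters c h"
      and hp: "\<And>i j s t. h (i + N * s, j + N * t) = h (i, j) + real_of_int s * a + real_of_int t * b" for h a b
    unfolding constant_on_clusters_def
  proof (intro allI impI)
    fix e assume e: "c' e"
    show "h (src e) = h (tgt e)"
    proof (cases "c e")
      case True
      then show ?thesis using h unfolding constant_on_clusters_def by blast
    next
      case False
      then obtain s t where "e = (False, N * s, N * t)" using only e by blast
      then show ?thesis
        using hp[of 0 s 0 t] hp[of 1 s 0 t] constant_on_clusters_conn[OF h conn]
        by (simp add: add.commute)
    qed
  qed
  then show "periods N c \<subseteq> periods N c'"
    unfolding periods_def by blast
qed

section \<open>Pivotal bonds\<close>

definition flip :: "'a \<Rightarrow> 'a set \<Rightarrow> 'a set" where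
  "flip e X = (if e \<in> X then X - {e} else insert e X)"

lemma mem_flip: "x \<in> flip e X \<longleftrightarrow> (if x = e then x \<notin> X else x \<in> X)"
  by (simp add: flip_def)

definition pivotal :: "'a set \<Rightarrow> ('a set \<Rightarrow> 'b) \<Rightarrow> 'a \<Rightarrow> 'a set set" where
  "pivotal E \<Phi> e = {X \<in> Pow E. \<Phi> X \<noteq> \<Phi> (flip e X)}"

text \<open>The configurations \<open>X - T \<union> Y \<inter> T\<close> interpolate between \<open>X\<close> and \<open>Y\<close>, and each of them is uniform
  if \<open>X\<close> and \<open>Y\<close> are.\<close>

lemma card_hybrid_le:
  assumes E: "finite E" and T: "T \<subseteq> E"
  shows "card {(X, Y) \<in> Pow E \<times> Pow E. \<Phi> X \<noteq> \<Phi> (X - T \<union> Y \<inter> T)} \<le> (\<Sum>e\<in>T. 2 ^ card E * card (pivotal E \<Phi> e))"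
  using finite_subset[OF T E] T
proof (induction T rule: finite_induct)
  case (insert e T)
  define mix where "mix = (\<lambda>X Y. X - T \<union> Y \<inter> T)"
  define A where "A = {(X, Y) \<in> Pow E \<times> Pow E. \<Phi> X \<noteq> \<Phi> (mix X Y)}"
  define B where "B = {(X, Y) \<in> Pow E \<times> Pow E. \<Phi> (mix X Y) \<noteq> \<Phi> (X - insert e T \<union> Y \<inter> insert e T)}"
  have "B \<subseteq> Pow E \<times> Pow E" by (auto simp: B_def)
  then have finB: "finite B" using E by (meson finite_Pow_iff finite_SigmaI finite_subset)
  have finP: "finite (pivotal E \<Phi> e)" using E by (simp add: pivotal_def)
  \<comment> \<open>Exchanging the coordinates in \<open>T\<close> between \<open>X\<close> and
    \<open>Y\<close> is an involution on pairs, hence injective, and its first component is the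
    current hybrid.\<close>
  have "card B \<le> card (pivotal E \<Phi> e \<times> Pow E)"
  proof (rule card_inj_on_le[where f = "\<lambda>(X, Y). (mix X Y, mix Y X)"])
    have "X = mix (mix X Y) (mix Y X)" for X Y by (auto simp: mix_def)
    then show "inj_on (\<lambda>(X, Y). (mix X Y, mix Y X)) B"
      by (intro inj_onI) (metis (no_types, lifting) case_prod_beta fst_conv prod.expand snd_conv)
    have "mix X Y \<in> pivotal E \<Phi> e" if "(X, Y) \<in> B" for X Y
    proof -
      \<comment> \<open>Adding \<open>e\<close> to the exchanged coordinates alters the hybrid at
        most at \<open>e\<close>, so a change of the value makes \<open>e\<close> pivotal.\<close>
      have "X - insert e T \<union> Y \<inter> insert e T \<in> {mix X Y, flip e (mix X Y)}"
        using insert.hyps(2) by (auto simp: mix_def flip_def)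
      then show ?thesis
        using that by (auto simp: B_def pivotal_def mix_def)
    qed
    moreover have "mix Y X \<in> Pow E" if "(X, Y) \<in> B" for X Y
      using that by (auto simp: B_def mix_def)
    ultimately show "(\<lambda>(X, Y). (mix X Y, mix Y X)) ` B \<subseteq> pivotal E \<Phi> e \<times> Pow E"
      by (intro image_subsetI) (metis (no_types, lifting) SigmaI case_prod_beta prod.collapse)
    show "finite (pivotal E \<Phi> e \<times> Pow E)" using finP E by simp
  qed
  then have B: "card B \<le> 2 ^ card E * card (pivotal E \<Phi> e)"
    using E by (simp add: card_cartesian_product card_Pow mult.commute)
  have "{(X, Y) \<in> Pow E \<times> Pow E. \<Phi> X \<noteq> \<Phi> (X - insert e T \<union> Y \<inter> insert e T)} \<subseteq> A \<union> B"
    by (auto simp: A_def B_def)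
  moreover have "finite (A \<union> B)"
    using finB E by (auto simp: A_def intro: finite_subset[of _ "Pow E \<times> Pow E"])
  ultimately have "card {(X, Y) \<in> Pow E \<times> Pow E. \<Phi> X \<noteq> \<Phi> (X - insert e T \<union> Y \<inter> insert e T)} \<le> card A + card B"
    by (meson card_Un_le card_mono order_trans)
  also have "card A \<le> (\<Sum>e\<in>T. 2 ^ card E * card (pivotal E \<Phi> e))"
    using insert.IH insert.prems unfolding A_def mix_def by simp
  finally show ?case using B insert.hyps by simp
qed simp

text \<open>Exchanging all coordinates turns \<open>X\<close> into \<open>Y\<close>. By the
  hypothesis at least half of all pairs have distinct values, and each such pair is charged to a
  pivotal coordinate.\<close>

lemma sum_pivotal_ge:
  assumes E: "finite E" and half: "\<And>v. 2 * card {X \<in> Pow E. \<Phi> X = v} \<le> 2 ^ card E"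
  shows "2 ^ card E \<le> 2 * (\<Sum>e\<in>E. card (pivotal E \<Phi> e))"
proof -
  define m :: nat where "m = 2 ^ card E"
  have m: "m = card (Pow E)" "m > 0" using E by (auto simp: m_def card_Pow)
  have "{(X, Y) \<in> Pow E \<times> Pow E. \<Phi> X \<noteq> \<Phi> (X - E \<union> Y \<inter> E)} = (SIGMA X:Pow E. {Y \<in> Pow E. \<Phi> Y \<noteq> \<Phi> X})"
    by (auto simp: Int_absorb2 Diff_eq_empty_iff[THEN iffD2])
  then have "card {(X, Y) \<in> Pow E \<times> Pow E. \<Phi> X \<noteq> \<Phi> (X - E \<union> Y \<inter> E)} = (\<Sum>X\<in>Pow E. card {Y \<in> Pow E. \<Phi> Y \<noteq> \<Phi> X})"
    using E by (simp add: card_SigmaI)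
  moreover have "m \<le> 2 * card {Y \<in> Pow E. \<Phi> Y \<noteq> \<Phi> X}" for X
  proof -
    have "{Y \<in> Pow E. \<Phi> Y \<noteq> \<Phi> X} = Pow E - {Y \<in> Pow E. \<Phi> Y = \<Phi> X}" by auto
    then have "card {Y \<in> Pow E. \<Phi> Y \<noteq> \<Phi> X} = m - card {Y \<in> Pow E. \<Phi> Y = \<Phi> X}"
      unfolding m(1) by (simp only:) (rule card_Diff_subset, use E in auto)
    then show ?thesis using half[of "\<Phi> X"] by (simp add: m_def)
  qed
  then have "(\<Sum>X\<in>Pow E. m) \<le> (\<Sum>X\<in>Pow E. 2 * card {Y \<in> Pow E. \<Phi> Y \<noteq> \<Phi> X})"
    by (intro sum_mono) auto
  ultimately have "m * m \<le> 2 * card {(X, Y) \<in> Pow E \<times> Pow E. \<Phi> X \<noteq> \<Phi> (X - E \<union> Y \<inter> E)}"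
    using m by (simp add: sum_distrib_left[symmetric])
  also have "\<dots> \<le> 2 * (\<Sum>e\<in>E. m * card (pivotal E \<Phi> e))"
    using card_hybrid_le[OF E subset_refl, of \<Phi>] by (simp add: m_def)
  finally have "m * m \<le> m * (2 * (\<Sum>e\<in>E. card (pivotal E \<Phi> e)))"
    by (simp add: sum_distrib_left mult.left_commute)
  then show ?thesis using m(2) by (simp add: m_def)
qed

section \<open>Configurations on the torus of odd side\<close>

definition box :: "int \<Rightarrow> bond set" where
  "box M = UNIV \<times> {- M..M} \<times> {- M..M}"

definition wrap :: "int \<Rightarrow> int \<Rightarrow> int" where
  "wrap M i = (i + M) mod (2 * M + 1) - M"

text \<open>Periodic extension. It encodes configurations of the torus of side
  \<open>2 * M + 1\<close> as subsets of a finite set of bonds, to which the counting of pivotal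
  elements applies.\<close>

definition unroll :: "int \<Rightarrow> bond set \<Rightarrow> config" where
  "unroll M X = (\<lambda>(v, i, j). (v, wrap M i, wrap M j) \<in> X)"

definition trace :: "int \<Rightarrow> config \<Rightarrow> bond set" where
  "trace M c = {e \<in> box M. c e}"

lemma finite_box: "finite (box M)"
  by (simp add: box_def)

lemma card_box: "M \<ge> 0 \<Longrightarrow> card (box M) = 2 * nat (2 * M + 1) ^ 2"
  by (simp add: box_def card_cartesian_product power2_eq_square algebra_simps)

lemma wrap_id: "- M \<le> i \<Longrightarrow> i \<le> M \<Longrightarrow> wrap M i = i"
  by (simp add: wrap_def)

lemma wrap_range: "M \<ge> 0 \<Longrightarrow> - M \<le> wrap M i \<and> wrap M i \<le> M"
  using pos_mod_bound[of "2 * M + 1" "i + M"] pos_mod_sign[of "2 * M + 1" "i + M"] unfolding wrap_def by linarith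

lemma wrap_decomp: "i = wrap M i + (2 * M + 1) * ((i + M) div (2 * M + 1))"
  using mult_div_mod_eq[of "2 * M + 1" "i + M"] unfolding wrap_def by linarith

lemma wrap_shift: "wrap M (i + (2 * M + 1) * s) = wrap M i"
proof -
  have "i + (2 * M + 1) * s + M = i + M + (2 * M + 1) * s" by simp
  then show ?thesis unfolding wrap_def by (simp only: mod_mult_self2)
qed

lemma periodic_unroll: "periodic (2 * M + 1) (unroll M X)"
  unfolding periodic_def unroll_def by (simp add: wrap_shift)

lemma unroll_box: "e \<in> box M \<Longrightarrow> unroll M X e \<longleftrightarrow> e \<in> X"
  by (cases e) (auto simp: box_def unroll_def wrap_id)

lemma unroll_trace:
  assumes "M \<ge> 0" "periodic (2 * M + 1) c"
  shows "unroll M (trace M c) = c"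
proof
  fix e :: bond
  obtain v i j where e: "e = (v, i, j)" by (cases e)
  have "c (v, wrap M i + (2 * M + 1) * ((i + M) div (2 * M + 1)), wrap M j + (2 * M + 1) * ((j + M) div (2 * M + 1)))
      = c (v, wrap M i, wrap M j)"
    using assms(2) unfolding periodic_def by blast
  then have "c (v, i, j) = c (v, wrap M i, wrap M j)"
    by (simp only: wrap_decomp[symmetric])
  then show "unroll M (trace M c) e = c e"
    using wrap_range[OF assms(1)] by (simp add: e unroll_def trace_def box_def)
qed

lemma trace_unroll: "X \<subseteq> box M \<Longrightarrow> trace M (unroll M X) = X"
  by (auto simp: trace_def unroll_box)

lemma trace_subset: "trace M c \<subseteq> box M"
  by (auto simp: trace_def)

text \<open>Dualizing twice is not the identity but the half turn about the midpoint of the central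
  bond.\<close>

lemma dual_dual: "dual (dual c) (v, i, j) = c (v, if v then 1 - i else - i, if v then - j - 1 else - j)"
  by simp

lemma dual_inj: "dual c = dual c' \<Longrightarrow> c = c'"
proof
  fix e :: bond assume eq: "dual c = dual c'"
  obtain v i j where e: "e = (v, i, j)" by (cases e)
  have "dual c (v, - j, if v then i - 1 else i) = dual c' (v, - j, if v then i - 1 else i)"
    using eq by simp
  then show "c e = c' e" by (cases v) (simp_all add: e)
qed

lemma periods_subset_dual_dual: "periods N c \<subseteq> periods N (dual (dual c))"
proof
  fix x assume "x \<in> periods N c"
  then obtain a b h where x: "x = (a, b)" and h: "constant_on_clusters c h"
    and hp: "\<And>i j s t. h (i + N * s, j + N * t) = h (i, j) + real_of_int s * a + real_of_int t * b"
    unfolding periods_def by blast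
  \<comment> \<open>The half turn reverses translations; the minus sign in front of \<open>h\<close>
    restores the periods.\<close>
  define k where "k = (\<lambda>(i, j). - h (1 - i, - j))"
  have "k (i + N * s, j + N * t) = k (i, j) + s * a + t * b" for i j s t
    using hp[of "1 - i" "- s" "- j" "- t"] by (simp add: k_def algebra_simps)
  moreover have "constant_on_clusters (dual (dual c)) k"
    unfolding constant_on_clusters_def
  proof (intro allI impI)
    fix e assume e: "dual (dual c) e"
    obtain v i j where vij: "e = (v, i, j)" by (cases e)
    define e' where "e' = (v, if v then 1 - i else - i, if v then - j - 1 else - j)"
    have "c e'" using e unfolding vij dual_dual e'_def .
    then have "h (src e') = h (tgt e')" using h unfolding constant_on_clusters_def by blast
    then show "k (src e) = k (tgt e)" by (cases v) (simp_all add: vij e'_def k_def)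
  qed
  ultimately show "x \<in> periods N (dual (dual c))" unfolding periods_def x by blast
qed

lemma periods_dual_dual: "periods N (dual (dual c)) = periods N c"
proof
  have "dual (dual (dual (dual c))) = c"
    by (rule ext, rename_tac e, case_tac e) simp
  then show "periods N (dual (dual c)) \<subseteq> periods N c"
    using periods_subset_dual_dual[of N "dual (dual c)"] by simp
qed (rule periods_subset_dual_dual)

abbreviation torus_periods :: "int \<Rightarrow> bond set \<Rightarrow> (real \<times> real) set" where
  "torus_periods M X \<equiv> periods (2 * M + 1) (unroll M X)"

text \<open>Duality acts injectively on the configurations of the torus and always changes the
  periods, so a level set is disjoint from its image, which is equally large.\<close>

lemma torus_periods_half:
  assumes M: "M \<ge> 0"
  shows "2 * card {X \<in> Pow (box M). torus_periods M X = v} \<le> 2 ^ card (box M)"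
proof -
  define A where "A = {X \<in> Pow (box M). torus_periods M X = v}"
  define \<tau> where "\<tau> = (\<lambda>X. trace M (dual (unroll M X)))"
  have \<tau>: "unroll M (\<tau> X) = dual (unroll M X)" for X
    unfolding \<tau>_def by (rule unroll_trace[OF M periodic_dual[OF periodic_unroll]])
  have "inj_on \<tau> (Pow (box M))"
  proof (rule inj_onI)
    fix X Y assume XY: "X \<in> Pow (box M)" "Y \<in> Pow (box M)" "\<tau> X = \<tau> Y"
    then have "unroll M X = unroll M Y" using \<tau> by (metis dual_inj)
    then show "X = Y" using XY trace_unroll by (metis Pow_iff)
  qed
  then have inj: "inj_on \<tau> A" by (rule inj_on_subset) (auto simp: A_def)
  have "\<tau> X \<notin> A" if "X \<in> A" for X
  proof -
    have "torus_periods M (\<tau> X) \<noteq> torus_periods M X"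
      unfolding \<tau> by (rule periods_dual_neq[OF periodic_unroll]) (use M in simp)
    then show ?thesis using that by (simp add: A_def)
  qed
  then have "\<tau> ` A \<inter> A = {}" by blast
  moreover have fin: "finite (Pow (box M))" by (simp add: finite_box)
  then have finA: "finite A" unfolding A_def by (rule finite_subset[rotated]) auto
  ultimately have "card (\<tau> ` A) + card A = card (\<tau> ` A \<union> A)"
    by (simp add: card_Un_disjoint)
  also have "\<dots> \<le> card (Pow (box M))"
    by (rule card_mono[OF fin]) (auto simp: A_def \<tau>_def trace_def)
  finally show ?thesis
    unfolding A_def[symmetric] using inj by (simp add: card_image card_Pow finite_box)
qed

text \<open>The symmetry of the torus carrying the central bond to \<open>(b, k, l)\<close>.\<close>

fun move :: "bool \<Rightarrow> int \<Rightarrow> int \<Rightarrow> bond \<Rightarrow> bond" where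
  "move b k l (v, i, j) = (if b then (\<not> v, j + k, i + l) else (v, i + k, j + l))"

lemma periodic_move: "periodic N c \<Longrightarrow> periodic N (c \<circ> move b k l)"
  unfolding periodic_def
proof (intro allI)
  fix v i j s t assume per: "\<forall>v i j s t. c (v, i + N * s, j + N * t) = c (v, i, j)"
  have "c (\<not> v, j + k + N * t, i + l + N * s) = c (\<not> v, j + k, i + l)"
     "c (v, i + k + N * s, j + l + N * t) = c (v, i + k, j + l)"
    using per by blast+
  then show "(c \<circ> move b k l) (v, i + N * s, j + N * t) = (c \<circ> move b k l) (v, i, j)"
    by (cases b) (simp_all add: algebra_simps)
qed

lemma move_surj: "\<exists>e'. move b k l e' = e"
proof -
  obtain v i j where "e = (v, i, j)" by (cases e)
  then have "move b k l (if b then (\<not> v, j - l, i - k) else (v, i - k, j - l)) = e" by simp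
  then show ?thesis ..
qed

lemma periods_move_subset:
  assumes "(x, y) \<in> periods N c"
  shows "(if b then (y, x) else (x, y)) \<in> periods N (c \<circ> move b k l)"
proof -
  from assms obtain h where h: "constant_on_clusters c h"
    and hp: "\<And>i j s t. h (i + N * s, j + N * t) = h (i, j) + real_of_int s * x + real_of_int t * y"
    unfolding periods_def by blast
  define g where "g = (\<lambda>(i, j). if b then h (j + k, i + l) else h (i + k, j + l))"
  have "g (i + N * s, j + N * t) = g (i, j) + s * (if b then y else x) + t * (if b then x else y)" for i j s t
    using hp[of "j + k" t "i + l" s] hp[of "i + k" s "j + l" t]
    by (cases b) (simp_all add: g_def algebra_simps)
  moreover have "constant_on_clusters (c \<circ> move b k l) g"
    unfolding constant_on_clusters_def
  proof (intro allI impI)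
    fix e assume e: "(c \<circ> move b k l) e"
    obtain v i j where vij: "e = (v, i, j)" by (cases e)
    have "h (src (move b k l e)) = h (tgt (move b k l e))"
      using e h unfolding constant_on_clusters_def o_def by blast
    then show "g (src e) = g (tgt e)" by (cases v; cases b) (simp_all add: vij g_def algebra_simps)
  qed
  ultimately show ?thesis unfolding periods_def by (cases b) auto
qed

lemma periods_move:
  "periods N (c \<circ> move b k l) = {(x, y). (if b then (y, x) else (x, y)) \<in> periods N c}"
proof (intro set_eqI iffI)
  fix z assume "z \<in> {(x, y). (if b then (y, x) else (x, y)) \<in> periods N c}"
  then show "z \<in> periods N (c \<circ> move b k l)"
    using periods_move_subset[of _ _ N c b k l] by (cases z; cases b) fastforce+
next
  fix z assume "z \<in> periods N (c \<circ> move b k l)"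
  moreover obtain x y where z: "z = (x, y)" by (cases z)
  ultimately have "(if b then (y, x) else (x, y)) \<in> periods N (c \<circ> move b k l \<circ> move b (if b then - l else - k) (if b then - k else - l))"
    using periods_move_subset by blast
  moreover have "c \<circ> move b k l \<circ> move b (if b then - l else - k) (if b then - k else - l) = c"
    by (rule ext, rename_tac e, case_tac e, cases b) simp_all
  ultimately show "z \<in> {(x, y). (if b then (y, x) else (x, y)) \<in> periods N c}"
    by (simp add: z)
qed

text \<open>Pulling back along \<open>move\<close> is injective, carries the flip at
  \<open>e\<close> to the flip at the central bond, and changes the periods at most by swapping
  their coordinates. It therefore preserves pivotality.\<close>

lemma card_pivotal_le_central:
  assumes M: "M \<ge> 0" and e: "e \<in> box M"
  shows "card (pivotal (box M) (torus_periods M) e) \<le> card (pivotal (box M) (torus_periods M) central_bond)"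
proof -
  obtain b k l where bkl: "e = (b, k, l)" by (cases e)
  have kl: "- M \<le> k" "k \<le> M" "- M \<le> l" "l \<le> M" using e by (auto simp: bkl box_def)
  define \<tau> where "\<tau> = (\<lambda>X. trace M (unroll M X \<circ> move b k l))"
  have \<tau>: "unroll M (\<tau> X) = unroll M X \<circ> move b k l" for X
    unfolding \<tau>_def by (rule unroll_trace[OF M periodic_move[OF periodic_unroll]])
  have inj: "inj_on \<tau> (Pow (box M))"
  proof (rule inj_onI)
    fix X Y assume XY: "X \<in> Pow (box M)" "Y \<in> Pow (box M)" "\<tau> X = \<tau> Y"
    then have "unroll M X \<circ> move b k l = unroll M Y \<circ> move b k l" using \<tau> by metis
    then have "unroll M X = unroll M Y"
      by (metis (no_types, opaque_lifting) comp_apply ext move_surj)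
    then show "X = Y" using XY trace_unroll by (metis Pow_iff)
  qed
  have wrap_eq: "wrap M (i + a) = a \<longleftrightarrow> i = 0" if "- M \<le> i" "i \<le> M" "- M \<le> a" "a \<le> M" for i a
  proof
    assume "wrap M (i + a) = a"
    then have "(2 * M + 1) dvd i" using wrap_decomp[of "i + a" M] by (metis add.commute add_left_cancel dvd_triv_left)
    then show "i = 0" using dvd_imp_le_int[of i "2 * M + 1"] that by linarith
  qed (simp add: wrap_id that)
  have wrap_move: "unroll M (flip e X) (move b k l x) = (if x = central_bond then \<not> unroll M X (move b k l x) else unroll M X (move b k l x))"
    if x: "x \<in> box M" for X x
  proof -
    obtain v i j where vij: "x = (v, i, j)" by (cases x)
    have ij: "- M \<le> i" "i \<le> M" "- M \<le> j" "j \<le> M" using x by (auto simp: vij box_def)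
    define y where "y = (if b then (\<not> v, wrap M (j + k), wrap M (i + l)) else (v, wrap M (i + k), wrap M (j + l)))"
    have y: "unroll M Z (move b k l x) = (y \<in> Z)" for Z
      by (simp add: unroll_def vij y_def)
    have "y = e \<longleftrightarrow> x = central_bond"
      using wrap_eq[of i k] wrap_eq[of i l] wrap_eq[of j k] wrap_eq[of j l] ij kl
      by (cases b) (simp_all add: y_def bkl vij conj_commute)
    then show ?thesis unfolding y mem_flip by simp
  qed
  have \<tau>_flip: "\<tau> (flip e X) = flip central_bond (\<tau> X)" for X
  proof -
    have "central_bond \<in> box M" using M by (simp add: box_def)
    moreover have "x \<in> \<tau> Z \<longleftrightarrow> x \<in> box M \<and> unroll M Z (move b k l x)" for x Z
      by (simp add: \<tau>_def trace_def)
    ultimately show ?thesis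
      using wrap_move by (intro set_eqI) (metis mem_flip)
  qed
  have "\<tau> ` pivotal (box M) (torus_periods M) e \<subseteq> pivotal (box M) (torus_periods M) central_bond"
  proof
    fix Y assume "Y \<in> \<tau> ` pivotal (box M) (torus_periods M) e"
    then obtain X where Y: "Y = \<tau> X" and X: "torus_periods M X \<noteq> torus_periods M (flip e X)"
      by (auto simp: pivotal_def)
    have "torus_periods M (\<tau> X) \<noteq> torus_periods M (\<tau> (flip e X))"
    proof
      assume "torus_periods M (\<tau> X) = torus_periods M (\<tau> (flip e X))"
      then have "{(x, y). (if b then (y, x) else (x, y)) \<in> torus_periods M X}
          = {(x, y). (if b then (y, x) else (x, y)) \<in> torus_periods M (flip e X)}"
        by (simp only: \<tau> periods_move)
      then have "z \<in> torus_periods M X \<longleftrightarrow> z \<in> torus_periods M (flip e X)" for z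
        by (cases z; cases b) (auto simp: set_eq_iff)
      then show False using X by blast
    qed
    then show "Y \<in> pivotal (box M) (torus_periods M) central_bond"
      using trace_subset by (simp add: Y pivotal_def \<tau>_flip) (simp add: \<tau>_def trace_subset)
  qed
  then show ?thesis
    by (intro card_inj_on_le[of \<tau>] inj_on_subset[OF inj]) (auto simp: pivotal_def finite_box)
qed

text \<open>One factor 2 in the constant comes from \<open>sum_pivotal_ge\<close>, the other from
  the two bonds starting at each vertex.\<close>

lemma card_pivotal_central_ge:
  assumes M: "M \<ge> 0"
  shows "2 ^ card (box M) \<le> 4 * nat (2 * M + 1) ^ 2 * card (pivotal (box M) (torus_periods M) central_bond)"
proof -
  have "2 ^ card (box M) \<le> 2 * (\<Sum>e\<in>box M. card (pivotal (box M) (torus_periods M) e))"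
    by (rule sum_pivotal_ge[OF finite_box torus_periods_half[OF M]])
  also have "\<dots> \<le> 2 * (\<Sum>e\<in>box M. card (pivotal (box M) (torus_periods M) central_bond))"
    by (intro mult_left_mono sum_mono card_pivotal_le_central[OF M]) auto
  finally show ?thesis using M by (simp add: card_box)
qed

section \<open>Short paths around a pivotal bond\<close>

definition near :: "nat \<Rightarrow> config \<Rightarrow> bool" where
  "near k c \<longleftrightarrow> (\<exists>n\<le>k. (step c ^^ n) (0, 0) (1, 0))"

text \<open>A walk of \<open>n\<close> steps from the origin uses only bonds that start within
  distance \<open>n\<close> in each coordinate, so it survives in any configuration that keeps the
  open bonds there.\<close>

lemma relpowp_local:
  assumes agree: "\<And>v i j. \<bar>i\<bar> \<le> K \<Longrightarrow> \<bar>j\<bar> \<le> K \<Longrightarrow> c (v, i, j) \<Longrightarrow> c' (v, i, j)"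
  shows "(step c ^^ n) (0, 0) q \<Longrightarrow> int n \<le> K \<Longrightarrow> conn c' (0, 0) q \<and> \<bar>fst q\<bar> \<le> n \<and> \<bar>snd q\<bar> \<le> n"
proof (induction n arbitrary: q)
  case (Suc n)
  then obtain p where p: "(step c ^^ n) (0, 0) p" "step c p q" by auto
  with Suc have IH: "conn c' (0, 0) p" "\<bar>fst p\<bar> \<le> n" "\<bar>snd p\<bar> \<le> n" by auto
  from p(2) obtain v i j where e: "c (v, i, j)"
     "p = src (v, i, j) \<and> q = tgt (v, i, j) \<or> p = tgt (v, i, j) \<and> q = src (v, i, j)"
    unfolding step_def by (metis prod.exhaust)
  have "\<bar>i\<bar> \<le> int n + 1 \<and> \<bar>j\<bar> \<le> int n + 1 \<and> \<bar>fst q\<bar> \<le> int n + 1 \<and> \<bar>snd q\<bar> \<le> int n + 1"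
    using e(2) IH(2,3) by (cases v) auto
  moreover from this have "c' (v, i, j)" using agree e(1) Suc.prems(2) by auto
  then have "step c' p q" using e(2) unfolding step_def by blast
  ultimately show ?case using IH(1) by auto
qed auto

text \<open>If the ends of the central bond were connected on the torus with all its translates
  closed, opening these would not change the periods. A path of length less than \<open>M\<close> in
  the plane would also exist on the torus. For the dual, the roles of open and closed are
  exchanged.\<close>

lemma pivotal_imp_not_near:
  assumes M: "M \<ge> 1" and piv: "trace M c \<in> pivotal (box M) (torus_periods M) central_bond"
    and k: "int k < M"
  shows "\<not> near k (without_central c)" "\<not> near k (without_central (dual c))"
proof -
  define N where "N = 2 * M + 1"
  define X1 where "X1 = trace M c - {central_bond}"
  define X2 where "X2 = insert central_bond (trace M c)"
  have cb: "central_bond \<in> box M" using M by (simp add: box_def)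
  have "torus_periods M X1 \<noteq> torus_periods M X2"
    using piv by (cases "central_bond \<in> trace M c") (auto simp: pivotal_def flip_def X1_def X2_def insert_absorb)
  then have neq: "periods N (unroll M X1) \<noteq> periods N (unroll M X2)" by (simp add: N_def)
  have mono: "unroll M X1 e \<Longrightarrow> unroll M X2 e" for e
    by (cases e) (auto simp: unroll_def X1_def X2_def)
  have only: "\<exists>s t. e = (False, N * s, N * t)" if "unroll M X2 e" "\<not> unroll M X1 e" for e
  proof -
    obtain v i j where e: "e = (v, i, j)" by (cases e)
    have "v = False" "wrap M i = 0" "wrap M j = 0"
      using that by (auto simp: e unroll_def X1_def X2_def)
    then show ?thesis using wrap_decomp[of i M] wrap_decomp[of j M] by (auto simp: e N_def)
  qed
  have *: "\<not> conn (unroll M X1) (0, 0) (1, 0)"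
    using periods_eq_if_connected[where c = "unroll M X1" and c' = "unroll M X2" and N = N, OF _ mono only] neq
    by metis
  show "\<not> near k (without_central c)"
  proof
    assume "near k (without_central c)"
    then obtain n where n: "n \<le> k" "(step (without_central c) ^^ n) (0, 0) (1, 0)"
      by (auto simp: near_def)
    have "unroll M X1 (v, i, j)" if "\<bar>i\<bar> \<le> M" "\<bar>j\<bar> \<le> M" "without_central c (v, i, j)" for v i j
    proof -
      have "(v, i, j) \<in> box M" using that by (auto simp: box_def)
      then show ?thesis using that(3) by (auto simp: unroll_box X1_def trace_def split: if_splits)
    qed
    from relpowp_local[where c' = "unroll M X1" and c = "without_central c" and K = M, OF this n(2)] * n(1) k show False by auto
  qed
  have **: "\<not> conn (dual (unroll M X2)) (0, 0) (1, 0)"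
  proof
    assume conn: "conn (dual (unroll M X2)) (0, 0) (1, 0)"
    have "periods N (dual (unroll M X1)) = periods N (dual (unroll M X2))"
    proof (rule periods_eq_if_connected[OF conn])
      fix e assume "dual (unroll M X2) e"
      then show "dual (unroll M X1) e" using mono by (cases e) auto
    next
      fix e assume e: "dual (unroll M X1) e" "\<not> dual (unroll M X2) e"
      obtain v i j where vij: "e = (v, i, j)" by (cases e)
      from e have "unroll M X2 (v, if v then j + 1 else j, - i)" "\<not> unroll M X1 (v, if v then j + 1 else j, - i)"
        by (auto simp: vij)
      from only[OF this] obtain s t where "(v, if v then j + 1 else j, - i) = (False, N * s, N * t)" by blast
      then have "e = (False, N * (- t), N * s)" by (auto simp: vij)
      then show "\<exists>s t. e = (False, N * s, N * t)" by blast
    qed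
    \<comment> \<open>The periods of a periodic configuration determine those of its dual, so the
      equality passes to the double duals.\<close>
    then have "periods N (dual (dual (unroll M X1))) = periods N (dual (dual (unroll M X2)))"
      using periods_dual[OF periodic_dual[OF periodic_unroll], of M] M by (simp add: N_def)
    then show False using neq by (simp add: periods_dual_dual)
  qed
  show "\<not> near k (without_central (dual c))"
  proof
    assume "near k (without_central (dual c))"
    then obtain n where n: "n \<le> k" "(step (without_central (dual c)) ^^ n) (0, 0) (1, 0)"
      by (auto simp: near_def)
    \<comment> \<open>The radius is \<open>M - 1\<close> because a vertical dual bond at
      \<open>(i, j)\<close> reads the bond at \<open>j + 1\<close>, which must still lie in the
      box.\<close>
    have "dual (unroll M X2) (v, i, j)" if "\<bar>i\<bar> \<le> M - 1" "\<bar>j\<bar> \<le> M - 1" "without_central (dual c) (v, i, j)" for v i j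
    proof -
      have "(v, if v then j + 1 else j, - i) \<in> box M" using that by (auto simp: box_def)
      then show ?thesis using that(3) by (auto simp: unroll_box X2_def trace_def split: if_splits)
    qed
    from relpowp_local[where c' = "dual (unroll M X2)" and c = "without_central (dual c)" and K = "M - 1", OF this n(2)] ** n(1) k show False by auto
  qed
qed

section \<open>Closed bonds between large clusters\<close>

lemma sum_Pow_weights:
  fixes a b :: real
  assumes "finite A" "a + b = 2"
  shows "(\<Sum>X\<in>Pow A. a ^ card X * b ^ card (A - X)) = 2 ^ card A"
  using prod_add[OF assms(1), of "\<lambda>_. a" "\<lambda>_. b"] assms(2) by simp

text \<open>\<open>T X\<close> is the set of bonds revealed by an exploration of \<open>X\<close>. Conditioned on what is revealed, the
  remaining bonds carry total weight \<open>(a + b)\<close> each, so the weights may be placed on all bonds.\<close>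

lemma sum_stopping_weights:
  fixes a b :: real
  assumes E: "finite E" and ab: "a + b = 2"
    and T: "\<And>X. X \<subseteq> E \<Longrightarrow> T X \<subseteq> E"
    and stop: "\<And>X Y. X \<subseteq> E \<Longrightarrow> Y \<subseteq> E \<Longrightarrow> Y \<inter> T X = X \<inter> T X \<Longrightarrow> T Y = T X"
  shows "(\<Sum>X\<in>Pow E. a ^ card (X \<inter> T X) * b ^ card (T X - X)) = 2 ^ card E"
proof -
  define f where "f = (\<lambda>X. a ^ card (X \<inter> T X) * b ^ card (T X - X))"
  define w where "w = (\<lambda>X. a ^ card X * b ^ card (E - X))"
  \<comment> \<open>The key is what the exploration reveals. Its classes consist of a fixed revealed
    part \<open>P\<close> together with an arbitrary subset of the unrevealed bonds
    \<open>E - S\<close>.\<close>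
  define key where "key = (\<lambda>X. (T X, X \<inter> T X))"
  have class_sum: "sum f {X \<in> Pow E. key X = key X0} = sum w {X \<in> Pow E. key X = key X0}" if X0: "X0 \<subseteq> E" for X0
  proof -
    define S where "S = T X0"
    define P where "P = X0 \<inter> S"
    have S: "S \<subseteq> E" "P \<subseteq> S" "P \<subseteq> E" using T[OF X0] X0 by (auto simp: S_def P_def)
    have T_eq: "T (P \<union> Z) = S" if "Z \<subseteq> E - S" for Z
      unfolding S_def by (rule stop) (use that X0 S in \<open>auto simp: P_def S_def\<close>)
    have class_eq: "{X \<in> Pow E. key X = key X0} = (\<lambda>Z. P \<union> Z) ` Pow (E - S)"
    proof (intro equalityI subsetI)
      fix X assume "X \<in> {X \<in> Pow E. key X = key X0}"
      then have "X \<subseteq> E" "X \<inter> S = P" by (auto simp: key_def S_def P_def)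
      then have "X = P \<union> (X - S)" "X - S \<in> Pow (E - S)" by auto
      then show "X \<in> (\<lambda>Z. P \<union> Z) ` Pow (E - S)" by blast
    next
      fix X assume "X \<in> (\<lambda>Z. P \<union> Z) ` Pow (E - S)"
      then obtain Z where Z: "Z \<subseteq> E - S" "X = P \<union> Z" by auto
      then show "X \<in> {X \<in> Pow E. key X = key X0}"
        using T_eq[OF Z(1)] S by (auto simp: key_def S_def[symmetric] P_def[symmetric])
    qed
    have inj: "inj_on (\<lambda>Z. P \<union> Z) (Pow (E - S))"
    proof (rule inj_onI)
      fix Z Z' assume Z: "Z \<in> Pow (E - S)" "Z' \<in> Pow (E - S)" "P \<union> Z = P \<union> Z'"
      then have "(P \<union> Z) - S = (P \<union> Z') - S" by simp
      then show "Z = Z'" using Z(1,2) S(2) by blast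
    qed
    have fin: "finite S" "finite P" "finite (E - S)" using E S by (auto intro: finite_subset)
    have f: "f (P \<union> Z) = a ^ card P * b ^ card (S - P)" if "Z \<subseteq> E - S" for Z
    proof -
      have "(P \<union> Z) \<inter> S = P" "S - (P \<union> Z) = S - P" using that S by auto
      then show ?thesis by (simp add: f_def T_eq[OF that])
    qed
    have w: "w (P \<union> Z) = a ^ card P * b ^ card (S - P) * (a ^ card Z * b ^ card (E - S - Z))"
      if "Z \<subseteq> E - S" for Z
    proof -
      have "card (P \<union> Z) = card P + card Z"
        using that fin S by (intro card_Un_disjoint) (auto intro: finite_subset)
      moreover have "E - (P \<union> Z) = (S - P) \<union> (E - S - Z)" using that S by auto
      then have "card (E - (P \<union> Z)) = card (S - P) + card (E - S - Z)"
        using fin by (simp add: card_Un_disjoint Int_Diff Diff_Int_distrib2 disjoint_iff)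
      ultimately show ?thesis by (simp add: w_def power_add)
    qed
    have "sum f {X \<in> Pow E. key X = key X0} = (\<Sum>Z\<in>Pow (E - S). a ^ card P * b ^ card (S - P))"
      unfolding class_eq by (simp add: sum.reindex[OF inj] f)
    also have "\<dots> = a ^ card P * b ^ card (S - P) * 2 ^ card (E - S)"
      using fin by (simp add: card_Pow)
    also have "\<dots> = (\<Sum>Z\<in>Pow (E - S). a ^ card P * b ^ card (S - P) * (a ^ card Z * b ^ card (E - S - Z)))"
      unfolding sum_distrib_left[symmetric] sum_Pow_weights[OF fin(3) ab] ..
    also have "\<dots> = sum w {X \<in> Pow E. key X = key X0}"
      unfolding class_eq by (simp add: sum.reindex[OF inj] w)
    finally show ?thesis .
  qed
  have fin: "finite (Pow E)" using E by simp
  have "sum f (Pow E) = (\<Sum>y\<in>key ` Pow E. sum f {X \<in> Pow E. key X = y})"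
    by (rule sum.image_gen[OF fin])
  also have "\<dots> = (\<Sum>y\<in>key ` Pow E. sum w {X \<in> Pow E. key X = y})"
    by (rule sum.cong) (use class_sum in auto)
  also have "\<dots> = sum w (Pow E)"
    by (rule sum.image_gen[OF fin, symmetric])
  also have "\<dots> = 2 ^ card E"
    unfolding w_def by (rule sum_Pow_weights[OF E ab])
  finally show ?thesis unfolding f_def .
qed

text \<open>Bound the two factors below by \<open>exp (s - s\<^sup>2)\<close> and
  \<open>exp (- s - 2 * s\<^sup>2)\<close>, then use that \<open>exp x\<close> is at least
  \<open>1 + x\<close>. This linearizes the likelihood ratio between a biased and the fair coin,
  with a quadratic error.\<close>

lemma likelihood_ratio_ge:
  fixes s :: real
  assumes "0 < s" "s \<le> 1 / 2"
  shows "1 + s * (real c - real o') - 2 * s\<^sup>2 * (real c + real o') \<le> (1 + s) ^ c * (1 - s) ^ o'"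
proof -
  have "exp (s - s\<^sup>2) \<le> 1 + s"
    using ln_one_plus_pos_lower_bound[of s] assms by (subst ln_ge_iff[symmetric]) auto
  then have 1: "exp (c * (s - s\<^sup>2)) \<le> (1 + s) ^ c"
    unfolding exp_of_nat_mult by (intro power_mono) auto
  have "exp (- s - 2 * s\<^sup>2) \<le> 1 - s"
    using ln_one_minus_pos_lower_bound[of s] assms by (subst ln_ge_iff[symmetric]) auto
  then have 2: "exp (o' * (- s - 2 * s\<^sup>2)) \<le> (1 - s) ^ o'"
    unfolding exp_of_nat_mult by (intro power_mono) auto
  have "1 + (c * (s - s\<^sup>2) + o' * (- s - 2 * s\<^sup>2)) \<le> exp (c * (s - s\<^sup>2) + o' * (- s - 2 * s\<^sup>2))"
    by (rule exp_ge_add_one_self)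
  also have "\<dots> \<le> (1 + s) ^ c * (1 - s) ^ o'"
    unfolding exp_add using 1 2 assms by (intro mult_mono) auto
  finally have "1 + (c * (s - s\<^sup>2) + o' * (- s - 2 * s\<^sup>2)) \<le> (1 + s) ^ c * (1 - s) ^ o'" .
  moreover have "1 + s * (real c - real o') - 2 * s\<^sup>2 * (real c + real o')
      = 1 + (c * (s - s\<^sup>2) + o' * (- s - 2 * s\<^sup>2)) - c * s\<^sup>2"
    by (simp add: algebra_simps)
  moreover have "0 \<le> c * s\<^sup>2" by simp
  ultimately show ?thesis by linarith
qed

section \<open>Exploration of clusters\<close>

definition cluster :: "bond set \<Rightarrow> vertex set \<Rightarrow> vertex set" where
  "cluster X A = {q. \<exists>p\<in>A. conn (\<lambda>e. e \<in> X) p q}"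

text \<open>For a union \<open>C\<close> of clusters, these are the bonds whose states are revealed
  when \<open>C\<close> is explored.\<close>

definition touching :: "bond set \<Rightarrow> vertex set \<Rightarrow> bond set" where
  "touching E C = {e \<in> E. src e \<in> C \<or> tgt e \<in> C}"

text \<open>Every step from a vertex of the explored set uses a touching bond, on which the two
  configurations agree. The exploration therefore runs identically in both, which is the stopping
  property.\<close>

lemma cluster_cong:
  assumes X: "X \<subseteq> E" and Y: "Y \<subseteq> E"
    and eq: "Y \<inter> touching E (cluster X A) = X \<inter> touching E (cluster X A)"
  shows "cluster Y A = cluster X A"
proof (intro equalityI subsetI)
  fix q assume "q \<in> cluster Y A"
  then obtain p where p: "p \<in> A" and pq: "conn (\<lambda>e. e \<in> Y) p q" by (auto simp: cluster_def)
  from pq show "q \<in> cluster X A"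
  proof (induction rule: rtranclp_induct)
    case base
    then show ?case using p by (auto simp: cluster_def)
  next
    case (step q r)
    then obtain e where e: "e \<in> Y" "q = src e \<and> r = tgt e \<or> q = tgt e \<and> r = src e"
      by (auto simp: step_def simp del: split_paired_Ex)
    then have "e \<in> Y \<inter> touching E (cluster X A)"
      using step.IH Y by (auto simp: touching_def)
    then have "e \<in> X" using eq by blast
    then have "step (\<lambda>e. e \<in> X) q r" using e(2) unfolding step_def by blast
    then show ?case using step.IH by (auto simp: cluster_def intro: rtranclp.rtrancl_into_rtrancl)
  qed
next
  fix q assume "q \<in> cluster X A"
  then obtain p where p: "p \<in> A" and pq: "conn (\<lambda>e. e \<in> X) p q" by (auto simp: cluster_def)
  from pq have "conn (\<lambda>e. e \<in> Y) p q \<and> q \<in> cluster X A"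
  proof (induction rule: rtranclp_induct)
    case base
    then show ?case using p by (auto simp: cluster_def)
  next
    case (step q r)
    then obtain e where e: "e \<in> X" "q = src e \<and> r = tgt e \<or> q = tgt e \<and> r = src e"
      by (auto simp: step_def simp del: split_paired_Ex)
    then have "e \<in> X \<inter> touching E (cluster X A)"
      using step.IH X by (auto simp: touching_def)
    then have "e \<in> Y" using eq by blast
    then have "step (\<lambda>e. e \<in> Y) q r" using e(2) unfolding step_def by blast
    then show ?case
      using step by (auto simp: cluster_def intro: rtranclp.rtrancl_into_rtrancl)
  qed
  then show "q \<in> cluster Y A" using p by (auto simp: cluster_def)
qed

lemma sum_cluster_weights:
  fixes a b :: real
  assumes "finite E" "a + b = 2"
  shows "(\<Sum>X\<in>Pow E. a ^ card (X \<inter> touching E (cluster X A)) * b ^ card (touching E (cluster X A) - X)) = 2 ^ card E"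
proof (rule sum_stopping_weights[OF assms])
  show "touching E (cluster X A) \<subseteq> E" for X by (auto simp: touching_def)
next
  fix X Y assume "X \<subseteq> E" "Y \<subseteq> E" "Y \<inter> touching E (cluster X A) = X \<inter> touching E (cluster X A)"
  then show "touching E (cluster Y A) = touching E (cluster X A)"
    by (intro arg_cong[where f = "touching E"]) (rule cluster_cong)
qed

text \<open>Closed bonds between two different clusters that both meet \<open>B\<close>. With a
  boundary layer of a box as \<open>B\<close>, this is the finite-volume trace of bonds between
  distinct infinite clusters.\<close>

definition bad :: "bond set \<Rightarrow> vertex set \<Rightarrow> bond set \<Rightarrow> bond set" where
  "bad E B X = {e \<in> E - X. src e \<in> cluster X B \<and> tgt e \<in> cluster X B \<and> \<not> conn (\<lambda>e. e \<in> X) (src e) (tgt e)}"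

lemma cluster_singleton_eq:
  assumes "p \<in> cluster X {v}"
  shows "cluster X {v} = cluster X {p}"
proof -
  have "conn (\<lambda>e. e \<in> X) v p" using assms by (simp add: cluster_def)
  from this conn_sym[OF this] show ?thesis
    unfolding cluster_def by (auto intro: rtranclp_trans)
qed

text \<open>A closed bond joining two clusters is seen twice when the clusters are explored separately,
  but only once when they are explored together.\<close>

lemma card_bad_le:
  fixes E B X
  assumes E: "finite E" and B: "finite B" and X: "X \<subseteq> E"
  defines "\<C> \<equiv> (\<lambda>v. cluster X {v}) ` B"
  defines "U \<equiv> touching E (cluster X B)"
  shows "real (card (bad E B X)) \<le>
     (\<Sum>C\<in>\<C>. real (card (touching E C - X)) - real (card (X \<inter> touching E C)))
       + (real (card (X \<inter> U)) - real (card (U - X)))"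
    and "(\<Sum>C\<in>\<C>. card (touching E C)) \<le> 2 * card E"
proof -
  \<comment> \<open>The number of distinct explored clusters at \<open>e\<close>. It is at most 2
    for every bond, at least 2 for a bad one, and at most 1 for an open one.\<close>
  define n where "n = (\<lambda>e. card {C \<in> \<C>. src e \<in> C \<or> tgt e \<in> C})"
  have fin\<C>: "finite \<C>" using B by (simp add: \<C>_def)
  have finX: "finite X" using X E by (rule finite_subset)
  have multi: "(\<Sum>C\<in>\<C>. card {e \<in> F. src e \<in> C \<or> tgt e \<in> C}) = sum n F" if "finite F" for F
    by (rule sum_multicount_gen[OF fin\<C> that]) (simp add: n_def del: split_paired_All)
  have unique: "C = cluster X {p}" if C: "C \<in> \<C>" and p: "p \<in> C" for C p
  proof -
    obtain v where "C = cluster X {v}" using C unfolding \<C>_def by blast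
    then show ?thesis using cluster_singleton_eq[of p X v] p by simp
  qed
  have sub: "{C \<in> \<C>. src e \<in> C \<or> tgt e \<in> C} \<subseteq> {cluster X {src e}, cluster X {tgt e}}" for e
    using unique by blast
  have n2: "n e \<le> 2" for e
  proof -
    have "n e \<le> card {cluster X {src e}, cluster X {tgt e}}"
      unfolding n_def by (rule card_mono[OF _ sub]) simp
    also have "\<dots> \<le> 2" by (simp add: card_insert_if)
    finally show ?thesis .
  qed
  have Un: "cluster X B = \<Union>\<C>" by (auto simp: \<C>_def cluster_def)
  have n_pos: "n e \<ge> 1" if "e \<in> U" for e
  proof -
    have "{C \<in> \<C>. src e \<in> C \<or> tgt e \<in> C} \<noteq> {}" using that by (auto simp: U_def touching_def Un)
    then show ?thesis using fin\<C> by (simp add: n_def Suc_le_eq card_gt_0_iff)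
  qed
  have n_open: "n e \<le> of_bool (e \<in> U)" if "e \<in> X" for e
  proof (cases "e \<in> U")
    case True
    have "step (\<lambda>e. e \<in> X) (src e) (tgt e)" using step_bond[of "\<lambda>e. e \<in> X"] that by blast
    then have "tgt e \<in> cluster X {src e}" by (auto simp: cluster_def)
    then have "cluster X {tgt e} = cluster X {src e}" using cluster_singleton_eq by metis
    then have "n e \<le> card {cluster X {src e}}"
      unfolding n_def using sub[of e] by (intro card_mono) auto
    then show ?thesis using True by simp
  next
    case False
    then have "{C \<in> \<C>. src e \<in> C \<or> tgt e \<in> C} = {}" using that X by (auto simp: U_def touching_def Un)
    then show ?thesis by (simp only: n_def) simp
  qed
  have n_bad: "n e \<ge> 2" if e: "e \<in> bad E B X" for e
  proof -
    have "cluster X {p} \<in> \<C>" if p: "p \<in> cluster X B" for p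
    proof -
      obtain C where "C \<in> \<C>" "p \<in> C" using p unfolding Un by blast
      then show ?thesis using unique[of C p] by simp
    qed
    then have "cluster X {src e} \<in> \<C>" "cluster X {tgt e} \<in> \<C>"
      using e by (auto simp only: bad_def mem_Collect_eq)
    moreover have "src e \<in> cluster X {src e}" "tgt e \<in> cluster X {tgt e}" by (auto simp: cluster_def)
    ultimately have "{cluster X {src e}, cluster X {tgt e}} \<subseteq> {C \<in> \<C>. src e \<in> C \<or> tgt e \<in> C}" by blast
    then have "card {cluster X {src e}, cluster X {tgt e}} \<le> n e"
      unfolding n_def using fin\<C> by (intro card_mono) auto
    moreover have "tgt e \<notin> cluster X {src e}" using e by (simp add: bad_def cluster_def)
    then have "cluster X {src e} \<noteq> cluster X {tgt e}" using \<open>tgt e \<in> cluster X {tgt e}\<close> by metis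
    ultimately show ?thesis by simp
  qed
  have bad_sub: "bad E B X \<subseteq> E - X" "bad E B X \<subseteq> U" by (auto simp: bad_def U_def touching_def)
  have "card (U - X) + card (bad E B X) = (\<Sum>e\<in>E - X. of_bool (e \<in> U) + of_bool (e \<in> bad E B X))"
  proof -
    have "(E - X) \<inter> {e. e \<in> U} = U - X" "(E - X) \<inter> {e. e \<in> bad E B X} = bad E B X"
      using bad_sub by (auto simp: U_def touching_def)
    then show ?thesis using E by (simp add: sum.distrib)
  qed
  also have "\<dots> \<le> sum n (E - X)"
  proof (rule sum_mono)
    fix e
    show "of_bool (e \<in> U) + of_bool (e \<in> bad E B X) \<le> n e"
      using n_pos[of e] n_bad[of e] bad_sub(2)
      by (cases "e \<in> bad E B X"; cases "e \<in> U") auto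
  qed
  also have "\<dots> = (\<Sum>C\<in>\<C>. card (touching E C - X))"
  proof -
    have "touching E C - X = {e \<in> E - X. src e \<in> C \<or> tgt e \<in> C}" for C by (auto simp: touching_def)
    then show ?thesis using multi[of "E - X"] E by simp
  qed
  finally have 1: "card (U - X) + card (bad E B X) \<le> (\<Sum>C\<in>\<C>. card (touching E C - X))" .
  have "(\<Sum>C\<in>\<C>. card (X \<inter> touching E C)) = sum n X"
  proof -
    have "X \<inter> touching E C = {e \<in> X. src e \<in> C \<or> tgt e \<in> C}" for C using X by (auto simp: touching_def)
    then show ?thesis using multi[of X] finX by simp
  qed
  also have "\<dots> \<le> (\<Sum>e\<in>X. of_bool (e \<in> U))" by (rule sum_mono[OF n_open])
  also have "\<dots> = card (X \<inter> U)" using finX by simp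
  finally have 2: "(\<Sum>C\<in>\<C>. card (X \<inter> touching E C)) \<le> card (X \<inter> U)" .
  show "real (card (bad E B X)) \<le>
     (\<Sum>C\<in>\<C>. real (card (touching E C - X)) - real (card (X \<inter> touching E C)))
       + (real (card (X \<inter> U)) - real (card (U - X)))"
    using of_nat_mono[OF 1, where ?'a = real] of_nat_mono[OF 2, where ?'a = real]
    by (simp add: sum_subtractf)
  have "(\<Sum>C\<in>\<C>. card (touching E C)) = sum n E"
    using multi[OF E] by (simp add: touching_def)
  also have "\<dots> \<le> (\<Sum>e\<in>E. 2)" by (rule sum_mono[OF n2])
  finally show "(\<Sum>C\<in>\<C>. card (touching E C)) \<le> 2 * card E" by simp
qed

text \<open>The Gandolfi-Grimmett-Russo argument in the exponential form of Cerf: a likelihood ratio bounds the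
  excess of closed over open bonds seen from each cluster.\<close>

lemma sum_card_bad_le:
  fixes s :: real
  assumes E: "finite E" and B: "finite B" and s: "0 < s" "s \<le> 1 / 2"
  shows "(\<Sum>X\<in>Pow E. real (card (bad E B X))) \<le> 2 ^ card E * (6 * s * card E + card B / s)"
proof -
  define m :: real where "m = 2 ^ card E"
  define t where "t = (\<lambda>X A. touching E (cluster X A))"
  define cl where "cl = (\<lambda>X A. real (card (t X A - X)))"
  define op where "op = (\<lambda>X A. real (card (X \<inter> t X A)))"
  define W where "W = (\<lambda>X A. (1 + s) ^ card (t X A - X) * (1 - s) ^ card (X \<inter> t X A))"
  have fint: "finite (t X A)" for X A using E by (simp add: t_def touching_def)
  have split: "card (t X A - X) + card (X \<inter> t X A) = card (t X A)" for X A
    using card_Int_Diff[OF fint, of X A X] by (simp add: Int_commute)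
  have tE: "card (t X A) \<le> card E" for X A
    using E by (intro card_mono) (auto simp: t_def touching_def)
  have W_nonneg: "W X A \<ge> 0" for X A using s by (simp add: W_def)
  have W_sum: "(\<Sum>X\<in>Pow E. W X A) = m" for A
    using sum_cluster_weights[OF E, of "1 - s" "1 + s" A]
    by (simp add: W_def t_def m_def mult.commute)
  \<comment> \<open>In the joint exploration the biased weights sum to exactly \<open>m\<close>,
    which cancels the summand 1 of the likelihood bound, so no term with \<open>1 / s\<close>
    arises.\<close>
  have opcl: "(\<Sum>X\<in>Pow E. op X A - cl X A) \<le> 2 * s * card E * m" for A
  proof -
    have "(\<Sum>X\<in>Pow E. 1 + s * (op X A - cl X A) - 2 * s\<^sup>2 * card E)
       \<le> (\<Sum>X\<in>Pow E. (1 + s) ^ card (X \<inter> t X A) * (1 - s) ^ card (t X A - X))"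
    proof (rule sum_mono)
      fix X
      have "2 * s\<^sup>2 * (op X A + cl X A) \<le> 2 * s\<^sup>2 * card E"
        using split[of X A] tE[of X A] by (intro mult_left_mono) (auto simp: op_def cl_def)
      then show "1 + s * (op X A - cl X A) - 2 * s\<^sup>2 * card E
          \<le> (1 + s) ^ card (X \<inter> t X A) * (1 - s) ^ card (t X A - X)"
        using likelihood_ratio_ge[OF s, of "card (X \<inter> t X A)" "card (t X A - X)"]
        by (simp add: op_def cl_def)
    qed
    also have "\<dots> = m"
      using sum_cluster_weights[OF E, of "1 + s" "1 - s" A] by (simp add: t_def m_def)
    finally have "s * (\<Sum>X\<in>Pow E. op X A - cl X A) \<le> m * (2 * s\<^sup>2 * card E)"
      using E by (simp add: sum.distrib sum_subtractf sum_distrib_left[symmetric] card_Pow m_def algebra_simps)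
    then have "s * (\<Sum>X\<in>Pow E. op X A - cl X A) \<le> s * (2 * s * card E * m)"
      by (simp add: power2_eq_square algebra_simps)
    then show ?thesis using s by simp
  qed
  have pointwise: "real (card (bad E B X)) \<le> 4 * s * card E + (\<Sum>v\<in>B. W X {v}) / s + (op X B - cl X B)"
    if X: "X \<subseteq> E" for X
  proof -
    define \<C> where "\<C> = (\<lambda>v. cluster X {v}) ` B"
    define \<rho> where "\<rho> = (\<lambda>C. (1 + s) ^ card (touching E C - X) * (1 - s) ^ card (X \<inter> touching E C))"
    have finC: "finite (touching E C)" for C using E by (simp add: touching_def)
    \<comment> \<open>Here the likelihood ratio stays on the right-hand side, divided by
      \<open>s\<close>; only its average over all configurations is controlled.\<close>
    have "real (card (touching E C - X)) - real (card (X \<inter> touching E C)) \<le> 2 * s * card (touching E C) + \<rho> C / s" for C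
    proof -
      have "card (touching E C - X) + card (X \<inter> touching E C) = card (touching E C)"
        using card_Int_Diff[OF finC, of C X] by (simp add: Int_commute)
      then have eq: "real (card (touching E C - X)) + real (card (X \<inter> touching E C)) = real (card (touching E C))"
        by linarith
      have "s * (real (card (touching E C - X)) - real (card (X \<inter> touching E C))) \<le> 2 * s\<^sup>2 * card (touching E C) + \<rho> C"
        using likelihood_ratio_ge[OF s, of "card (touching E C - X)" "card (X \<inter> touching E C)"]
        unfolding eq \<rho>_def by linarith
      also have "\<dots> = s * (2 * s * card (touching E C) + \<rho> C / s)"
        using s by (simp add: field_simps power2_eq_square)
      finally show ?thesis using s by (simp only: mult_le_cancel_left_pos)
    qed
    then have "(\<Sum>C\<in>\<C>. real (card (touching E C - X)) - real (card (X \<inter> touching E C)))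
        \<le> (\<Sum>C\<in>\<C>. 2 * s * card (touching E C) + \<rho> C / s)" by (rule sum_mono)
    also have "\<dots> = 2 * s * real (\<Sum>C\<in>\<C>. card (touching E C)) + sum \<rho> \<C> / s"
      by (simp add: sum.distrib sum_distrib_left sum_divide_distrib)
    also have "\<dots> \<le> 2 * s * real (2 * card E) + (\<Sum>v\<in>B. W X {v}) / s"
    proof (intro add_mono mult_left_mono divide_right_mono of_nat_mono)
      show "(\<Sum>C\<in>\<C>. card (touching E C)) \<le> 2 * card E"
        unfolding \<C>_def by (rule card_bad_le(2)[OF E B X])
      \<comment> \<open>Different vertices of \<open>B\<close> may share a cluster. Since the
        weights are nonnegative, summing over vertices only increases the total.\<close>
      have "sum \<rho> \<C> \<le> sum (\<rho> \<circ> (\<lambda>v. cluster X {v})) B"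
        unfolding \<C>_def by (rule sum_image_le[OF B]) (use s in \<open>simp add: \<rho>_def\<close>)
      then show "sum \<rho> \<C> \<le> (\<Sum>v\<in>B. W X {v})"
        by (simp add: \<rho>_def W_def t_def o_def)
    qed (use s in auto)
    finally show ?thesis
      using card_bad_le(1)[OF E B X] by (simp add: op_def cl_def t_def \<C>_def)
  qed
  have "(\<Sum>X\<in>Pow E. real (card (bad E B X)))
      \<le> (\<Sum>X\<in>Pow E. 4 * s * card E + (\<Sum>v\<in>B. W X {v}) / s + (op X B - cl X B))"
    by (rule sum_mono) (use pointwise in auto)
  also have "\<dots> = m * (4 * s * card E) + (\<Sum>X\<in>Pow E. \<Sum>v\<in>B. W X {v}) / s + (\<Sum>X\<in>Pow E. op X B - cl X B)"
    using E by (simp add: sum.distrib card_Pow m_def sum_divide_distrib)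
  also have "(\<Sum>X\<in>Pow E. \<Sum>v\<in>B. W X {v}) = card B * m"
    by (subst sum.swap) (simp add: W_sum)
  finally show ?thesis using opcl[of B] by (simp add: m_def[symmetric] algebra_simps)
qed

section \<open>Percolation as a random configuration\<close>

abbreviation coin :: "bool measure" where
  "coin \<equiv> measure_pmf (bernoulli_pmf (1 / 2))"

text \<open>The product runs over the whole type of bonds, so every function is a configuration and
  no extensionality condition remains.\<close>

definition config_measure :: "config measure" where
  "config_measure = (\<Pi>\<^sub>M e\<in>UNIV. coin)"

lemma emeasure_coin_eq: "emeasure coin {b. (b = t) \<in> S} = emeasure coin S"
proof -
  have "map_pmf (\<lambda>b. b = t) (bernoulli_pmf (1 / 2)) = bernoulli_pmf (1 / 2)"
  proof (rule pmf_eqI)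
    fix i :: bool
    have "(\<lambda>b. b = t) -` {i} = {i = t}" by auto
    then show "pmf (map_pmf (\<lambda>b. b = t) (bernoulli_pmf (1 / 2))) i = pmf (bernoulli_pmf (1 / 2)) i"
      by (cases "i = t"; cases i) (simp_all add: pmf_map measure_pmf_single)
  qed
  then have "emeasure coin S = emeasure (map_pmf (\<lambda>b. b = t) (bernoulli_pmf (1 / 2))) S" by simp
  also have "\<dots> = emeasure coin {b. (b = t) \<in> S}"
    by (simp add: vimage_def)
  finally show ?thesis ..
qed

text \<open>The value \<open>s e\<close> decides whether the coin at \<open>f e\<close> is copied or
  complemented. This covers translations, duality, changing a single bond and the passage from edges
  to bonds. Cylinder sets suffice for the proof, and injectivity keeps their coordinates
  independent.\<close>

lemma distr_PiM_coin_reindex: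
  fixes f :: "'a \<Rightarrow> 'b" and s :: "'a \<Rightarrow> bool"
  assumes inj: "inj f" and range: "range f \<subseteq> K"
  shows "distr (\<Pi>\<^sub>M i\<in>K. coin) (\<Pi>\<^sub>M e\<in>UNIV. coin) (\<lambda>\<omega> e. \<omega> (f e) = s e) = (\<Pi>\<^sub>M e\<in>UNIV. coin)"
    and "(\<lambda>\<omega> e. \<omega> (f e) = s e) \<in> (\<Pi>\<^sub>M i\<in>K. coin) \<rightarrow>\<^sub>M (\<Pi>\<^sub>M e\<in>UNIV. coin)"
proof -
  let ?F = "\<lambda>\<omega> e. \<omega> (f e) = s e"
  interpret product_prob_space "\<lambda>_::'b. coin" K by unfold_locales
  interpret U: product_prob_space "\<lambda>_::'a. coin" UNIV by unfold_locales
  have coord: "(\<lambda>\<omega>. ?F \<omega> e) \<in> (\<Pi>\<^sub>M i\<in>K. coin) \<rightarrow>\<^sub>M coin" for e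
  proof -
    have "(\<lambda>\<omega>. \<omega> (f e)) \<in> (\<Pi>\<^sub>M i\<in>K. coin) \<rightarrow>\<^sub>M coin"
      by (rule measurable_component_singleton) (use range in auto)
    then show ?thesis by (rule measurable_compose) simp
  qed
  show F: "?F \<in> (\<Pi>\<^sub>M i\<in>K. coin) \<rightarrow>\<^sub>M (\<Pi>\<^sub>M e\<in>UNIV. coin)"
    by (rule measurable_PiM_single'[OF coord]) simp
  show "distr (\<Pi>\<^sub>M i\<in>K. coin) (\<Pi>\<^sub>M e\<in>UNIV. coin) ?F = (\<Pi>\<^sub>M e\<in>UNIV. coin)"
  proof (rule measure_eqI_PiM_infinite)
    show "finite_measure (distr (\<Pi>\<^sub>M i\<in>K. coin) (\<Pi>\<^sub>M e\<in>UNIV. coin) ?F)"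
      using prob_space_distr[OF F] by (simp add: prob_space_def)
  next
    fix A :: "'a \<Rightarrow> bool set" and J assume J: "finite J" "J \<subseteq> (UNIV :: 'a set)"
    define P where "P = prod_emb UNIV (\<lambda>_. coin) J (Pi\<^sub>E J A)"
    have P_eq: "P = {c \<in> space (\<Pi>\<^sub>M e\<in>UNIV. coin). \<forall>j\<in>J. c j \<in> A j}"
      by (auto simp: P_def prod_emb_def space_PiM PiE_def Pi_def)
    have P: "emeasure (\<Pi>\<^sub>M e\<in>UNIV. coin) P = (\<Prod>j\<in>J. emeasure coin (A j))"
      unfolding P_eq by (rule U.emeasure_PiM_Collect) (use J in auto)
    have P_sets: "P \<in> sets (\<Pi>\<^sub>M e\<in>UNIV. coin)"
      unfolding P_def by (rule sets_PiM_I) (use J in auto)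
    have "?F -` P \<inter> space (\<Pi>\<^sub>M i\<in>K. coin)
        = {\<omega> \<in> space (\<Pi>\<^sub>M i\<in>K. coin). \<forall>i\<in>f ` J. \<omega> i \<in> {b. (b = s (inv f i)) \<in> A (inv f i)}}"
      using inj by (auto simp: P_eq space_PiM)
    then have "emeasure (distr (\<Pi>\<^sub>M i\<in>K. coin) (\<Pi>\<^sub>M e\<in>UNIV. coin) ?F) P
        = emeasure (\<Pi>\<^sub>M i\<in>K. coin) {\<omega> \<in> space (\<Pi>\<^sub>M i\<in>K. coin). \<forall>i\<in>f ` J. \<omega> i \<in> {b. (b = s (inv f i)) \<in> A (inv f i)}}"
      by (simp add: emeasure_distr[OF F P_sets])
    also have "\<dots> = (\<Prod>i\<in>f ` J. emeasure coin {b. (b = s (inv f i)) \<in> A (inv f i)})"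
      by (rule emeasure_PiM_Collect) (use J range in auto)
    also have "\<dots> = (\<Prod>j\<in>J. emeasure coin (A j))"
      using inj by (simp add: prod.reindex inj_on_subset[OF inj] emeasure_coin_eq)
    finally show "emeasure (distr (\<Pi>\<^sub>M i\<in>K. coin) (\<Pi>\<^sub>M e\<in>UNIV. coin) ?F) (prod_emb UNIV (\<lambda>_. coin) J (Pi\<^sub>E J A))
        = emeasure (\<Pi>\<^sub>M e\<in>UNIV. coin) (prod_emb UNIV (\<lambda>_. coin) J (Pi\<^sub>E J A))"
      using P unfolding P_def by simp
  qed simp_all
qed

interpretation configs: prob_space config_measure
  unfolding config_measure_def by (intro prob_space_PiM prob_space_measure_pmf)

lemma space_config_measure [simp]: "space config_measure = UNIV"
  by (simp add: config_measure_def space_PiM)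

lemma measurable_bond [measurable]: "Measurable.pred config_measure (\<lambda>c. c e)"
proof -
  have "(\<lambda>c. c e) \<in> config_measure \<rightarrow>\<^sub>M coin"
    unfolding config_measure_def by (rule measurable_component_singleton) simp
  then show ?thesis by (simp cong: measurable_cong_sets)
qed

lemma measure_config_trace:
  assumes E: "finite E" and Y: "Y \<subseteq> Pow E"
  shows "configs.prob {c. {e \<in> E. c e} \<in> Y} = card Y / 2 ^ card E"
    and "{c. {e \<in> E. c e} \<in> Y} \<in> configs.events"
proof -
  interpret product_prob_space "\<lambda>_::bond. coin" UNIV by unfold_locales
  have finY: "finite Y" using finite_subset[OF Y] E by simp
  have [measurable]: "{c. {e \<in> E. c e} = X} \<in> configs.events" for X
  proof -
    have eq: "{e \<in> E. c e} = X \<longleftrightarrow> X \<subseteq> E \<and> (\<forall>e\<in>E. c e = (e \<in> X))" for c by auto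
    have "Measurable.pred config_measure (\<lambda>c. X \<subseteq> E \<and> (\<forall>e\<in>E. c e = (e \<in> X)))"
      using countable_finite[OF E] by measurable
    then show ?thesis unfolding eq pred_def by simp
  qed
  have single: "configs.prob {c. {e \<in> E. c e} = X} = 1 / 2 ^ card E" if X: "X \<in> Y" for X
  proof -
    have "{c. {e \<in> E. c e} = X} = {c \<in> space (\<Pi>\<^sub>M e\<in>UNIV. coin). \<forall>e\<in>E. c e \<in> {e \<in> X}}"
      using X Y by (auto simp: space_PiM)
    then have "emeasure config_measure {c. {e \<in> E. c e} = X} = (\<Prod>e\<in>E. emeasure coin {e \<in> X})"
      unfolding config_measure_def using emeasure_PiM_Collect[of E "\<lambda>e. {e \<in> X}"] E by simp
    also have "\<dots> = (\<Prod>e\<in>E. ennreal (1 / 2))"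
      by (rule prod.cong[OF refl], rename_tac e, case_tac "e \<in> X") (simp_all add: emeasure_pmf_single)
    also have "\<dots> = ennreal (1 / 2 ^ card E)"
      by (simp only: prod_constant ennreal_power[of "1 / 2" "card E"]) (simp add: power_divide)
    finally show ?thesis by (simp add: measure_eq_emeasure_eq_ennreal)
  qed
  have Un: "{c. {e \<in> E. c e} \<in> Y} = (\<Union>X\<in>Y. {c. {e \<in> E. c e} = X})" by auto
  then have "configs.prob {c. {e \<in> E. c e} \<in> Y} = (\<Sum>X\<in>Y. configs.prob {c. {e \<in> E. c e} = X})"
    by (simp only:) (rule configs.finite_measure_finite_Union[OF finY], auto simp: disjoint_family_on_def)
  then show "configs.prob {c. {e \<in> E. c e} \<in> Y} = card Y / 2 ^ card E" by (simp add: single)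
  show "{c. {e \<in> E. c e} \<in> Y} \<in> configs.events"
    unfolding Un using finY by (intro sets.finite_UN) auto
qed

lemma measure_config_reindex:
  assumes inj: "inj f" and A: "A \<in> configs.events"
  shows "configs.prob {c. (\<lambda>e. c (f e) = s e) \<in> A} = configs.prob A"
    and "{c. (\<lambda>e. c (f e) = s e) \<in> A} \<in> configs.events"
proof -
  have F: "(\<lambda>c e. c (f e) = s e) \<in> config_measure \<rightarrow>\<^sub>M config_measure"
    unfolding config_measure_def by (rule distr_PiM_coin_reindex(2)[OF inj]) simp
  have "configs.prob A = measure (distr config_measure config_measure (\<lambda>c e. c (f e) = s e)) A"
    using distr_PiM_coin_reindex(1)[OF inj, of UNIV s] by (simp add: config_measure_def)
  then show "configs.prob {c. (\<lambda>e. c (f e) = s e) \<in> A} = configs.prob A"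
    using measure_distr[OF F A] by (simp add: vimage_def)
  show "{c. (\<lambda>e. c (f e) = s e) \<in> A} \<in> configs.events"
    using measurable_sets[OF F A] by (simp add: vimage_def)
qed

lemma pred_relpowp_step [measurable]: "Measurable.pred config_measure (\<lambda>c. (step c ^^ n) p q)"
proof -
  have step: "Measurable.pred config_measure (\<lambda>c. step c p q)" for p q
    unfolding step_def by measurable
  show ?thesis
  proof (induction n arbitrary: q)
    case (Suc n)
    have "Measurable.pred config_measure (\<lambda>c. \<exists>r. (step c ^^ n) p r \<and> step c r q)"
      by (intro pred_intros_countable pred_intros_logic Suc.IH step)
    then show ?case by (simp add: relcompp.simps)
  qed simp
qed

lemma pred_conn [measurable]: "Measurable.pred config_measure (\<lambda>c. conn c p q)"
  unfolding rtranclp_power by measurable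

lemma pred_near [measurable]: "Measurable.pred config_measure (\<lambda>c. near k c)"
  unfolding near_def by measurable

section \<open>Bonds between distinct infinite clusters\<close>

abbreviation square :: "int \<Rightarrow> vertex set" where
  "square n \<equiv> {- n..n} \<times> {- n..n}"

text \<open>Quantifiers over countable types replace infinity, which makes the existence of an
  infinite cluster measurable.\<close>

lemma infinite_iff_not_subset_square: "infinite S \<longleftrightarrow> (\<forall>n. \<exists>z\<in>S. z \<notin> square n)"
proof
  assume "infinite S"
  then show "\<forall>n. \<exists>z\<in>S. z \<notin> square n"
    using finite_subset[of S "square n" for n] by blast
next
  assume out: "\<forall>n. \<exists>z\<in>S. z \<notin> square n"
  show "infinite S"
  proof
    assume "finite S"
    then have "finite ((\<lambda>z. max \<bar>fst z\<bar> \<bar>snd z\<bar>) ` S)" by simp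
    then obtain m where "\<And>z. z \<in> S \<Longrightarrow> max \<bar>fst z\<bar> \<bar>snd z\<bar> \<le> m"
      by (meson bdd_above_def bdd_above_finite imageI)
    then show False using out[rule_format, of m] by fastforce
  qed
qed

lemma pred_infinite_cluster [measurable]:
  "Measurable.pred config_measure (\<lambda>c. infinite {z. conn c p z})"
  unfolding infinite_iff_not_subset_square Bex_def mem_Collect_eq by measurable

definition separates_infinite :: "bond \<Rightarrow> config \<Rightarrow> bool" where
  "separates_infinite e c \<longleftrightarrow> \<not> c e \<and> \<not> conn c (src e) (tgt e) \<and>
     infinite {z. conn c (src e) z} \<and> infinite {z. conn c (tgt e) z}"

lemma pred_separates_infinite [measurable]: "Measurable.pred config_measure (separates_infinite e)"
  unfolding separates_infinite_def by measurable

lemma conn_move_imp: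
  "conn c (i + k, j + l) q \<Longrightarrow> conn (c \<circ> move False k l) (i, j) (fst q - k, snd q - l)"
proof (induction rule: rtranclp_induct)
  case (step q r)
  then obtain v x y where e: "c (v, x, y)" "q = src (v, x, y) \<and> r = tgt (v, x, y) \<or> q = tgt (v, x, y) \<and> r = src (v, x, y)"
    unfolding step_def by (metis prod.exhaust)
  have "(c \<circ> move False k l) (v, x - k, y - l)" using e(1) by simp
  from step_bond[of "c \<circ> move False k l", OF this] step_sym[OF step_bond[of "c \<circ> move False k l", OF this]]
  have "step (c \<circ> move False k l) (fst q - k, snd q - l) (fst r - k, snd r - l)"
    using e(2) by (cases v) (auto simp: algebra_simps)
  with step.IH show ?case by (rule rtranclp.rtrancl_into_rtrancl)
qed simp

lemma conn_move:
  "conn (c \<circ> move False k l) (i, j) (x, y) \<longleftrightarrow> conn c (i + k, j + l) (x + k, y + l)"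
proof
  have "c \<circ> move False k l \<circ> move False (- k) (- l) = c"
    by (rule ext, rename_tac e, case_tac e) simp
  then show "conn c (i + k, j + l) (x + k, y + l)" if "conn (c \<circ> move False k l) (i, j) (x, y)"
    using conn_move_imp[of "c \<circ> move False k l" "i + k" "- k" "j + l" "- l" "(x, y)"] that by simp
next
  show "conn (c \<circ> move False k l) (i, j) (x, y)" if "conn c (i + k, j + l) (x + k, y + l)"
    using conn_move_imp[OF that] by simp
qed

lemma infinite_cluster_move:
  assumes "infinite {z. conn c (i + k, j + l) z}"
  shows "infinite {z. conn (c \<circ> move False k l) (i, j) z}"
proof -
  have "inj_on (\<lambda>z. (fst z - k, snd z - l)) {z. conn c (i + k, j + l) z}"
    by (auto simp: inj_on_def)
  then have "infinite ((\<lambda>z. (fst z - k, snd z - l)) ` {z. conn c (i + k, j + l) z})"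
    using assms finite_image_iff by blast
  then show ?thesis
    by (rule infinite_super[rotated]) (auto intro: conn_move_imp)
qed

lemma separates_infinite_move_imp:
  assumes "separates_infinite (v, i + k, j + l) c"
  shows "separates_infinite (v, i, j) (c \<circ> move False k l)"
  using assms infinite_cluster_move[of c i k j l] infinite_cluster_move[of c "i + 1" k j l]
    infinite_cluster_move[of c i k "j + 1" l]
  by (cases v) (simp_all add: separates_infinite_def conn_move algebra_simps)

lemma separates_infinite_move:
  "separates_infinite (v, i, j) (c \<circ> move False k l) \<longleftrightarrow> separates_infinite (v, i + k, j + l) c"
proof
  have "c \<circ> move False k l \<circ> move False (- k) (- l) = c"
    by (rule ext, rename_tac e, case_tac e) simp
  then show "separates_infinite (v, i + k, j + l) c" if "separates_infinite (v, i, j) (c \<circ> move False k l)"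
    using separates_infinite_move_imp[of v "i + k" "- k" "j + l" "- l" "c \<circ> move False k l"] that by simp
qed (rule separates_infinite_move_imp)

lemma prob_separates_infinite:
  "configs.prob {c. separates_infinite (False, i, j) c} = configs.prob {c. separates_infinite central_bond c}"
proof -
  have "inj (move False i j)" by (auto simp: inj_on_def)
  moreover have "{c. separates_infinite central_bond c} \<in> configs.events"
    using pred_separates_infinite[of central_bond] by (simp add: pred_def)
  ultimately have "configs.prob {c. (\<lambda>e. c (move False i j e) = True) \<in> {c. separates_infinite central_bond c}}
     = configs.prob {c. separates_infinite central_bond c}"
    by (rule measure_config_reindex)
  then show ?thesis
    using separates_infinite_move[of False 0 0 _ i j] by (simp add: o_def)
qed

text \<open>Unless \<open>p\<close> is joined to the boundary layer by open bonds of the box, the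
  walk stays in \<open>square (n - 1)\<close>, and all bonds incident to that square lie in the
  box.\<close>

lemma conn_trace_box:
  assumes "conn c p z" "p \<in> square n"
  shows "conn (\<lambda>e. e \<in> trace n c) p z \<and> z \<in> square n \<or>
    p \<in> cluster (trace n c) (square (n + 1) - square (n - 1))"
  using assms(1)
proof (induction rule: rtranclp_induct)
  case base
  then show ?case using assms(2) by simp
next
  case (step q r)
  show ?case
  proof (cases "p \<in> cluster (trace n c) (square (n + 1) - square (n - 1))")
    case False
    with step.IH have pq: "conn (\<lambda>e. e \<in> trace n c) p q" and q: "q \<in> square n" by auto
    have nb: "b \<in> square (n - 1)" if "conn (\<lambda>e. e \<in> trace n c) p b" "b \<in> square (n + 1)" for b
      using conn_sym[OF that(1)] that(2) False by (auto simp: cluster_def)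
    have q': "q \<in> square (n - 1)" using nb[OF pq] q by auto
    from step.hyps(2) obtain e where e: "c e" "q = src e \<and> r = tgt e \<or> q = tgt e \<and> r = src e"
      unfolding step_def by blast
    obtain v i j where vij: "e = (v, i, j)" by (cases e)
    have "e \<in> box n" "r \<in> square n"
      using q' e(2) by (cases v; auto simp: vij box_def)+
    then have "step (\<lambda>e. e \<in> trace n c) q r"
      using e unfolding step_def trace_def by blast
    then show ?thesis using pq \<open>r \<in> square n\<close> by auto
  qed simp
qed

text \<open>An infinite cluster leaves the square and so reaches the boundary layer, while
  restricting to the box cannot create connections.\<close>

lemma separates_infinite_imp_bad:
  assumes "separates_infinite e c" "e \<in> box n" "tgt e \<in> square n"
  shows "e \<in> bad (box n) (square (n + 1) - square (n - 1)) (trace n c)"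
proof -
  have src: "src e \<in> square n" using assms(2) by (cases e) (auto simp: box_def)
  have "p \<in> cluster (trace n c) (square (n + 1) - square (n - 1))"
    if "infinite {z. conn c p z}" "p \<in> square n" for p
    using that conn_trace_box[of c p _ n] unfolding infinite_iff_not_subset_square by blast
  moreover have "conn c p q" if "conn (\<lambda>e. e \<in> trace n c) p q" for p q
    using that by (rule conn_mono) (simp add: trace_def)
  ultimately show ?thesis
    using assms src by (auto simp: separates_infinite_def bad_def trace_def)
qed

text \<open>All horizontal bonds have the same probability, so that it is bounded by the expected number of bad
  bonds in a box divided by the volume of the box.\<close>

lemma prob_separates_infinite_le:
  fixes s :: real and n :: int
  assumes s: "0 < s" "s \<le> 1 / 2" and n: "n \<ge> 1"
  shows "configs.prob {c. separates_infinite central_bond c} \<le> 24 * s + 16 / (s * (2 * n + 1))"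
proof -
  define P where "P = configs.prob {c. separates_infinite central_bond c}"
  define B where "B = square (n + 1) - square (n - 1)"
  \<comment> \<open>Horizontal bonds with both ends in the square, hence the strict upper bound on
    the first coordinate.\<close>
  define H where "H = {False} \<times> {- n..<n} \<times> {- n..n}"
  define m :: real where "m = 2 ^ card (box n)"
  have m: "m > 0" by (simp add: m_def)
  have P_nonneg: "P \<ge> 0" by (simp add: P_def)
  have H: "e \<in> box n" "tgt e \<in> square n" if "e \<in> H" for e
    using that by (auto simp: H_def box_def)
  have finH: "finite H" by (simp add: H_def)
  have bnd: "P \<le> card {X \<in> Pow (box n). e \<in> bad (box n) B X} / m" if e: "e \<in> H" for e
  proof -
    define Y where "Y = {X \<in> Pow (box n). e \<in> bad (box n) B X}"
    have Y: "Y \<subseteq> Pow (box n)" by (auto simp: Y_def)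
    have "P = configs.prob {c. separates_infinite e c}"
      using e prob_separates_infinite[of "fst (snd e)" "snd (snd e)"] unfolding P_def H_def by (cases e) simp
    also have "\<dots> \<le> configs.prob {c. {e \<in> box n. c e} \<in> Y}"
    proof (rule configs.finite_measure_mono)
      show "{c. {e \<in> box n. c e} \<in> Y} \<in> configs.events"
        by (rule measure_config_trace(2)[OF finite_box Y])
      show "{c. separates_infinite e c} \<subseteq> {c. {e \<in> box n. c e} \<in> Y}"
        using separates_infinite_imp_bad[of e _ n] H[OF e] unfolding Y_def B_def trace_def by auto
    qed
    also have "\<dots> = card Y / m"
      unfolding m_def by (rule measure_config_trace[OF finite_box Y])
    finally show ?thesis by (simp add: Y_def)
  qed
  have "real (card H) * P = (\<Sum>e\<in>H. P)" by simp
  also have "\<dots> \<le> (\<Sum>e\<in>H. card {X \<in> Pow (box n). e \<in> bad (box n) B X} / m)"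
    by (rule sum_mono[OF bnd])
  also have "\<dots> = (\<Sum>e\<in>H. card {X \<in> Pow (box n). e \<in> bad (box n) B X}) / m"
    by (simp add: sum_divide_distrib)
  also have "(\<Sum>e\<in>H. card {X \<in> Pow (box n). e \<in> bad (box n) B X}) = (\<Sum>X\<in>Pow (box n). card {e \<in> H. e \<in> bad (box n) B X})"
    using finH by (intro sum_multicount_gen[symmetric]) (auto simp: finite_box)
  also have "real \<dots> \<le> (\<Sum>X\<in>Pow (box n). real (card (bad (box n) B X)))"
    unfolding of_nat_sum by (intro sum_mono of_nat_mono card_mono) (auto simp: bad_def finite_box)
  also have "\<dots> \<le> m * (6 * s * card (box n) + card B / s)"
    unfolding m_def by (rule sum_card_bad_le[OF finite_box _ s]) (simp add: B_def)
  finally have "real (card H) * P \<le> 6 * s * card (box n) + card B / s"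
    using m by (simp add: divide_right_mono)
  moreover have "real (card H) = 2 * real_of_int n * (2 * n + 1)"
    using n by (simp add: H_def card_cartesian_product)
  moreover have "real (card (box n)) = 2 * (2 * real_of_int n + 1)\<^sup>2"
    using n by (simp add: card_box)
  moreover have "real (card B) = 8 * (2 * real_of_int n + 1)"
  proof -
    have square: "real (card (square m)) = (2 * real_of_int m + 1)\<^sup>2" if "m \<ge> 0" for m
      using that by (simp add: card_cartesian_product power2_eq_square)
    have "square (n - 1) \<subseteq> square (n + 1)" by auto
    then have "card (square (n + 1)) = card B + card (square (n - 1))"
      unfolding B_def using card_Diff_subset[of "square (n - 1)" "square (n + 1)"]
        card_mono[of "square (n + 1)" "square (n - 1)"] by simp
    then have "real (card (square (n + 1))) = real (card B) + real (card (square (n - 1)))"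
      by simp
    then show ?thesis
      using square[of "n + 1"] square[of "n - 1"] n by (simp add: power2_eq_square algebra_simps)
  qed
  ultimately have "2 * n * (2 * n + 1) * P \<le> 12 * s * (2 * n + 1)\<^sup>2 + 8 * (2 * n + 1) / s"
    by (simp add: algebra_simps)
  also have "\<dots> = (2 * real_of_int n + 1) * (12 * s * (2 * n + 1) + 8 / s)"
    by (simp add: power2_eq_square algebra_simps add_divide_distrib)
  finally have "(2 * real_of_int n + 1) * (2 * n * P) \<le> (2 * real_of_int n + 1) * (12 * s * (2 * n + 1) + 8 / s)"
    by (simp add: mult_ac)
  then have "2 * n * P \<le> 12 * s * (2 * n + 1) + 8 / s"
    using n by (subst (asm) mult_le_cancel_left_pos) auto
  moreover have "(2 * n + 1) * P \<le> 4 * n * P"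
    using n P_nonneg by (intro mult_right_mono) auto
  ultimately have "(2 * n + 1) * P \<le> 24 * s * (2 * n + 1) + 16 / s" by linarith
  then have "P \<le> (24 * s * (2 * n + 1) + 16 / s) / (2 * n + 1)"
    using n by (simp add: pos_le_divide_eq mult.commute)
  also have "\<dots> = 24 * s + 16 / (s * (2 * n + 1))"
    using n by (simp add: add_divide_distrib)
  finally show ?thesis unfolding P_def .
qed

text \<open>Taking \<open>s = 1 / m\<close> and \<open>n = m\<^sup>2\<close> makes both terms of the
  bound of order \<open>1 / m\<close>.\<close>

lemma prob_separates_infinite_0: "configs.prob {c. separates_infinite central_bond c} = 0"
proof -
  define P where "P = configs.prob {c. separates_infinite central_bond c}"
  have "P \<le> 32 / real m" if m: "m \<ge> 2" for m
  proof -
    have "P \<le> 24 * (1 / real m) + 16 / (1 / real m * (2 * (real m)\<^sup>2 + 1))"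
      using prob_separates_infinite_le[of "1 / real m" "int m ^ 2"] m by (simp add: P_def field_simps)
    also have "16 / (1 / real m * (2 * (real m)\<^sup>2 + 1)) \<le> 16 / (1 / real m * (2 * (real m)\<^sup>2))"
      using m by (intro divide_left_mono mult_left_mono mult_pos_pos add_pos_pos) auto
    also have "\<dots> = 8 / real m" using m by (simp add: field_simps power2_eq_square)
    finally show ?thesis by simp
  qed
  then have "P \<le> 0"
    by (intro LIMSEQ_le_const[OF lim_const_over_n[of 32]]) auto
  then show ?thesis unfolding P_def by (simp add: measure_le_0_iff)
qed

section \<open>Long connections around the central bond\<close>

text \<open>The event splits according to the state of the central bond. The part \<open>T'\<close>
  with the bond open is obtained from the part \<open>T\<close> with the bond closed by changing
  that bond, so both have the same probability.\<close>

lemma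
  assumes Q[measurable]: "Measurable.pred config_measure Q"
  shows pred_without_central: "Measurable.pred config_measure (\<lambda>c. Q (without_central c))"
    and prob_without_central_le:
      "configs.prob {c. Q (without_central c)} \<le> 2 * configs.prob {c. Q c \<and> \<not> c central_bond}"
proof -
  define T where "T = {c. Q c \<and> \<not> c central_bond}"
  define T' where "T' = {c. (\<lambda>e. c (id e) = (e \<noteq> central_bond)) \<in> T}"
  have "{c \<in> space config_measure. Q c \<and> \<not> c central_bond} \<in> configs.events" by measurable
  then have T: "T \<in> configs.events" by (simp add: T_def)
  have T': "T' \<in> configs.events" "configs.prob T' = configs.prob T"
    unfolding T'_def by (rule measure_config_reindex[OF inj_on_id T])+
  have eq: "{c. Q (without_central c)} = T \<union> T'"
  proof (intro set_eqI)
    fix c :: config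
    show "c \<in> {c. Q (without_central c)} \<longleftrightarrow> c \<in> T \<union> T'"
    proof (cases "c central_bond")
      case True
      then have "(\<lambda>e. c (id e) = (e \<noteq> central_bond)) = without_central c" by (intro ext) simp
      then show ?thesis using True by (simp add: T_def T'_def)
    next
      case False
      then have "without_central c = c" by (intro ext) simp
      then show ?thesis using False by (simp add: T_def T'_def)
    qed
  qed
  show "Measurable.pred config_measure (\<lambda>c. Q (without_central c))"
    using T T'(1) eq by (simp add: pred_def)
  have "configs.prob {c. Q (without_central c)} \<le> configs.prob T + configs.prob T'"
    unfolding eq by (rule measure_Un_le[OF T T'(1)])
  then show "configs.prob {c. Q (without_central c)} \<le> 2 * configs.prob {c. Q c \<and> \<not> c central_bond}"
    using T'(2) by (simp add: T_def)
qed

text \<open>Self-duality at density one half: \<open>dual\<close> permutes the bonds and complements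
  fair coins.\<close>

lemma prob_dual:
  assumes "Measurable.pred config_measure Q"
  shows "Measurable.pred config_measure (\<lambda>c. Q (dual c))"
    and "configs.prob {c. Q (dual c)} = configs.prob {c. Q c}"
proof -
  define f :: "bond \<Rightarrow> bond" where "f = (\<lambda>(v, i, j). (v, if v then j + 1 else j, - i))"
  have dual: "dual c = (\<lambda>e. c (f e) = False)" for c
    by (rule ext, rename_tac e, case_tac e) (simp add: f_def)
  have inj: "inj f" by (auto simp: inj_on_def f_def split: if_splits)
  have Q: "{c. Q c} \<in> configs.events" using assms by (simp add: pred_def)
  from measure_config_reindex[OF inj Q, of "\<lambda>_. False"]
  show "Measurable.pred config_measure (\<lambda>c. Q (dual c))" "configs.prob {c. Q (dual c)} = configs.prob {c. Q c}"
    unfolding dual by (simp_all add: pred_def)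
qed

lemma not_connected_imp_separates_infinite:
  assumes "\<not> conn (without_central c) (0, 0) (1, 0)" "\<not> conn (without_central (dual c)) (0, 0) (1, 0)"
  shows "separates_infinite central_bond (without_central c)"
proof -
  have "\<not> conn (without_central c) (1, 0) (0, 0)" using assms(1) conn_sym by blast
  then show ?thesis
    using infinite_cluster_if_not_connected[of "(0, 0)" "(1, 0)" c] infinite_cluster_if_not_connected[of "(1, 0)" "(0, 0)" c] assms
    by (simp add: separates_infinite_def)
qed

lemma prob_not_near_ge:
  "1 / (4 * (2 * real k + 3)\<^sup>2)
     \<le> configs.prob {c. \<not> near k (without_central c) \<and> \<not> near k (without_central (dual c))}"
proof -
  \<comment> \<open>The least \<open>M\<close> exceeding \<open>k\<close>; the torus has side
    \<open>2 * k + 3\<close>.\<close>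
  define M where "M = int k + 1"
  define Y where "Y = pivotal (box M) (torus_periods M) central_bond"
  have Y: "Y \<subseteq> Pow (box M)" by (auto simp: Y_def pivotal_def)
  note [measurable] = pred_without_central[OF pred_near] prob_dual(1)[OF pred_without_central[OF pred_near]]
  have "{c \<in> space config_measure. \<not> near k (without_central c) \<and> \<not> near k (without_central (dual c))} \<in> configs.events"
    by measurable
  then have A: "{c. \<not> near k (without_central c) \<and> \<not> near k (without_central (dual c))} \<in> configs.events"
    by simp
  have "real (2 ^ card (box M)) \<le> real (4 * nat (2 * M + 1) ^ 2 * card Y)"
    unfolding Y_def by (intro of_nat_mono card_pivotal_central_ge) (simp add: M_def)
  also have "nat (2 * M + 1) = 2 * k + 3" by (simp add: M_def)
  finally have "2 ^ card (box M) \<le> 4 * (2 * real k + 3)\<^sup>2 * card Y" by simp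
  moreover have "0 < 4 * (2 * real k + 3)\<^sup>2" by (simp add: add_nonneg_pos)
  ultimately have "1 / (4 * (2 * real k + 3)\<^sup>2) \<le> card Y / 2 ^ card (box M)"
    by (simp add: field_simps)
  also have "\<dots> = configs.prob {c. {e \<in> box M. c e} \<in> Y}"
    by (rule measure_config_trace(1)[OF finite_box Y, symmetric])
  also have "\<dots> \<le> configs.prob {c. \<not> near k (without_central c) \<and> \<not> near k (without_central (dual c))}"
    using pivotal_imp_not_near[of M _ k]
    by (intro configs.finite_measure_mono[OF _ A]) (auto simp: Y_def trace_def M_def)
  finally show ?thesis .
qed

text \<open>If neither the configuration nor its dual has a short path avoiding the central bond,
  then one of them has a long one, up to the null event \<open>B3\<close>. Choosing between the two
  costs a factor 2 by duality, and forcing the central bond to be closed costs another.\<close>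

lemma prob_connected_not_near_ge:
  "1 / (16 * (2 * real k + 3)\<^sup>2) \<le> configs.prob {c. conn c (0, 0) (1, 0) \<and> \<not> near k c}"
proof -
  define Q where "Q = (\<lambda>c. conn c (0, 0) (1, 0) \<and> \<not> near k c)"
  define A where "A = {c. \<not> near k (without_central c) \<and> \<not> near k (without_central (dual c))}"
  define B1 where "B1 = {c. Q (without_central c)}"
  define B2 where "B2 = {c. Q (without_central (dual c))}"
  define B3 where "B3 = {c. separates_infinite central_bond (without_central c)}"
  have Q: "Measurable.pred config_measure Q" unfolding Q_def by measurable
  have ev: "{c. R c} \<in> configs.events" if "Measurable.pred config_measure R" for R
    using that by (simp add: pred_def)
  have [measurable]: "B1 \<in> configs.events" "B2 \<in> configs.events" "B3 \<in> configs.events"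
    unfolding B1_def B2_def B3_def
    by (intro ev pred_without_central pred_separates_infinite Q prob_dual(1)[OF pred_without_central])+
  have B3: "configs.prob B3 = 0"
  proof -
    have "configs.prob B3 \<le> 2 * configs.prob {c. separates_infinite central_bond c \<and> \<not> c central_bond}"
      unfolding B3_def by (rule prob_without_central_le[OF pred_separates_infinite])
    also have "{c. separates_infinite central_bond c \<and> \<not> c central_bond} = {c. separates_infinite central_bond c}"
      by (auto simp: separates_infinite_def)
    finally show ?thesis by (simp add: prob_separates_infinite_0 measure_le_0_iff)
  qed
  have "1 / (4 * (2 * real k + 3)\<^sup>2) \<le> configs.prob A"
    unfolding A_def by (rule prob_not_near_ge)
  also have "\<dots> \<le> configs.prob (B1 \<union> B2 \<union> B3)"
  proof (rule configs.finite_measure_mono)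
    show "A \<subseteq> B1 \<union> B2 \<union> B3"
      using not_connected_imp_separates_infinite by (auto simp: A_def B1_def B2_def B3_def Q_def)
  qed measurable
  also have "\<dots> \<le> configs.prob B1 + configs.prob B2 + configs.prob B3"
    using measure_Un_le[of "B1 \<union> B2" config_measure B3] measure_Un_le[of B1 config_measure B2]
    by simp
  also have "configs.prob B2 = configs.prob B1"
    unfolding B1_def B2_def by (rule prob_dual(2)[OF pred_without_central[OF Q]])
  also have "configs.prob B1 \<le> 2 * configs.prob {c. Q c \<and> \<not> c central_bond}"
    unfolding B1_def by (rule prob_without_central_le[OF Q])
  also have "configs.prob {c. Q c \<and> \<not> c central_bond} \<le> configs.prob {c. Q c}"
    using ev[OF Q] by (intro configs.finite_measure_mono) auto
  finally show ?thesis by (simp add: B3 Q_def field_simps)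
qed

section \<open>The chemical distance\<close>

definition lattice_edge :: "bond \<Rightarrow> edge" where
  "lattice_edge e = {src e, tgt e}"

definition bond_config :: "(edge \<Rightarrow> bool) \<Rightarrow> config" where
  "bond_config \<omega> = (\<lambda>e. \<omega> (lattice_edge e))"

lemma inj_lattice_edge: "inj lattice_edge"
proof (rule injI)
  fix e e' assume "lattice_edge e = lattice_edge e'"
  then show "e = e'"
    by (cases e; cases e') (auto simp: lattice_edge_def doubleton_eq_iff split: if_splits)
qed

lemma adjacent_src_tgt: "adjacent (src e) (tgt e)"
  by (cases e) (auto simp: adjacent_def)

lemma step_bond_config: "step (bond_config \<omega>) u v \<longleftrightarrow> adjacent u v \<and> \<omega> {u, v}"
proof
  assume "step (bond_config \<omega>) u v"
  then obtain e where "\<omega> (lattice_edge e)" "u = src e \<and> v = tgt e \<or> u = tgt e \<and> v = src e"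
    unfolding step_def bond_config_def by blast
  then show "adjacent u v \<and> \<omega> {u, v}"
    using adjacent_src_tgt[of e] by (auto simp: lattice_edge_def insert_commute adjacent_def abs_minus_commute)
next
  assume uv: "adjacent u v \<and> \<omega> {u, v}"
  obtain i j k l where ij: "u = (i, j)" "v = (k, l)" by (cases u; cases v)
  have "(k = i + 1 \<and> l = j) \<or> (k = i - 1 \<and> l = j) \<or> (k = i \<and> l = j + 1) \<or> (k = i \<and> l = j - 1)"
    using uv by (auto simp: ij adjacent_def)
  then have "\<exists>e. u = src e \<and> v = tgt e \<or> u = tgt e \<and> v = src e"
  proof (elim disjE)
    assume "k = i + 1 \<and> l = j"
    then show ?thesis by (intro exI[of _ "(False, i, j)"]) (simp add: ij)
  next
    assume "k = i - 1 \<and> l = j"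
    then show ?thesis by (intro exI[of _ "(False, k, l)"]) (simp add: ij)
  next
    assume "k = i \<and> l = j + 1"
    then show ?thesis by (intro exI[of _ "(True, i, j)"]) (simp add: ij)
  next
    assume "k = i \<and> l = j - 1"
    then show ?thesis by (intro exI[of _ "(True, k, l)"]) (simp add: ij)
  qed
  then obtain e where e: "u = src e \<and> v = tgt e \<or> u = tgt e \<and> v = src e" ..
  then have "lattice_edge e = {u, v}" by (auto simp: lattice_edge_def)
  then show "step (bond_config \<omega>) u v" using e uv unfolding step_def bond_config_def by metis
qed

lemma open_path_imp_relpowp:
  "open_path \<omega> x p y \<Longrightarrow> (step (bond_config \<omega>) ^^ (length p - 1)) x y"
proof (induction p arbitrary: x rule: induct_list012)
  case (3 u v p)
  then have "step (bond_config \<omega>) x v" "open_path \<omega> v (v # p) y"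
    by (auto simp: open_path_def step_bond_config split: if_splits)
  then have "(step (bond_config \<omega>) ^^ Suc (length (v # p) - 1)) x y"
    by (intro relpowp_Suc_I2[of _ x v] "3.IH"(2))
  then show ?case by simp
qed (auto simp: open_path_def)

lemma relpowp_imp_open_path:
  "(step (bond_config \<omega>) ^^ n) x y \<Longrightarrow> \<exists>p. open_path \<omega> x p y \<and> length p = Suc n"
proof (induction n arbitrary: x)
  case 0
  then show ?case by (intro exI[of _ "[x]"]) (simp add: open_path_def)
next
  case (Suc n)
  then obtain z where z: "step (bond_config \<omega>) x z" "(step (bond_config \<omega>) ^^ n) z y"
    by (meson relpowp_Suc_D2)
  from Suc.IH[OF z(2)] obtain p where p: "open_path \<omega> z p y" "length p = Suc n" by blast
  then show ?case using z(1)
    by (intro exI[of _ "x # p"]) (cases p; auto simp: open_path_def step_bond_config)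
qed

lemma path_connected_to_if_conn: "conn (bond_config \<omega>) x y \<Longrightarrow> path_connected_to \<omega> x y"
  unfolding path_connected_to_def rtranclp_power using relpowp_imp_open_path by blast

lemma chem_dist_gt:
  assumes "conn (bond_config \<omega>) (0, 0) (1, 0)" "\<not> near k (bond_config \<omega>)"
  shows "k < chem_dist \<omega> (0, 0) (1, 0)"
proof -
  obtain p where "open_path \<omega> (0, 0) p (1, 0)"
    using path_connected_to_if_conn[OF assms(1)] by (auto simp: path_connected_to_def)
  then have "\<exists>n p. open_path \<omega> (0, 0) p (1, 0) \<and> length p - 1 = n" by blast
  \<comment> \<open>The minimum is attained because a path exists; otherwise \<open>LEAST\<close>
    would be unspecified.\<close>
  then obtain q where "open_path \<omega> (0, 0) q (1, 0)" "length q - 1 = chem_dist \<omega> (0, 0) (1, 0)"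
    using that LeastI_ex[of "\<lambda>n. \<exists>p. open_path \<omega> (0, 0) p (1, 0) \<and> length p - 1 = n"] unfolding chem_dist_def by blast
  then have "(step (bond_config \<omega>) ^^ chem_dist \<omega> (0, 0) (1, 0)) (0, 0) (1, 0)"
    using open_path_imp_relpowp by metis
  then show ?thesis using assms(2) unfolding near_def by (meson not_le)
qed

text \<open>Sums of consecutive odd numbers are squares; these are the weights that express a second
  moment through tail probabilities.\<close>

lemma sum_odd_le_square: "(\<Sum>k<n. (2 * k + 1) * of_bool (k < d)) \<le> (d :: nat)\<^sup>2"
proof -
  have "(\<Sum>k<n. (2 * k + 1) * of_bool (k < d)) = (min n d)\<^sup>2"
  proof (induction n)
    case (Suc n)
    then show ?case by (cases "n < d") (simp_all add: min_absorb1 min_absorb2 power2_eq_square)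
  qed simp
  also have "\<dots> \<le> d\<^sup>2" by (intro power_mono) auto
  finally show ?thesis .
qed

theorem proposition3:
  shows "(\<integral>\<^sup>+ \<omega>. ennreal ((real (chem_dist \<omega> (0, 0) (1, 0)))\<^sup>2)
            \<partial>uniform_measure critical_percolation (connection_event (0, 0) (1, 0))) = \<infinity>"
proof -
  define C where "C = connection_event (0, 0) (1, 0)"
  define d where "d = (\<lambda>\<omega>. chem_dist \<omega> (0, 0) (1, 0))"
  define D where "D = (\<lambda>k. {\<omega> \<in> space critical_percolation. \<omega> \<in> C \<and> k < d \<omega>})"
  define L where "L = (\<integral>\<^sup>+ \<omega>. ennreal ((real (d \<omega>))\<^sup>2) * indicator C \<omega> \<partial>critical_percolation)"
  have C[measurable]: "C \<in> sets critical_percolation" unfolding C_def by (rule sets_connection_event)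
  have d[measurable]: "d \<in> critical_percolation \<rightarrow>\<^sub>M count_space UNIV" unfolding d_def by (rule measurable_chem_dist)
  have D[measurable]: "D k \<in> sets critical_percolation" for k unfolding D_def by measurable
  have range: "range lattice_edge \<subseteq> lattice_edges"
    using adjacent_src_tgt unfolding lattice_edges_def lattice_edge_def by blast
  have bond_config: "bond_config = (\<lambda>\<omega> e. \<omega> (lattice_edge e) = True)"
    by (simp add: bond_config_def fun_eq_iff)
  have F: "bond_config \<in> critical_percolation \<rightarrow>\<^sub>M config_measure"
    unfolding bond_config critical_percolation_def config_measure_def
    by (rule distr_PiM_coin_reindex(2)[OF inj_lattice_edge range])
  have distr: "distr critical_percolation config_measure bond_config = config_measure"
    unfolding bond_config critical_percolation_def config_measure_def
    by (rule distr_PiM_coin_reindex(1)[OF inj_lattice_edge range])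
  have tail: "ennreal (1 / (16 * (2 * real k + 3)\<^sup>2)) \<le> emeasure critical_percolation (D k)" for k
  proof -
    define S where "S = {c. conn c (0, 0) (1, 0) \<and> \<not> near k c}"
    have "{c \<in> space config_measure. conn c (0, 0) (1, 0) \<and> \<not> near k c} \<in> configs.events" by measurable
    then have S: "S \<in> configs.events" by (simp add: S_def)
    have "ennreal (1 / (16 * (2 * real k + 3)\<^sup>2)) \<le> emeasure config_measure S"
      using prob_connected_not_near_ge[of k] unfolding configs.emeasure_eq_measure S_def by (rule ennreal_leI)
    also have "\<dots> = emeasure critical_percolation (bond_config -` S \<inter> space critical_percolation)"
      by (subst distr[symmetric]) (rule emeasure_distr[OF F S])
    also have "\<dots> \<le> emeasure critical_percolation (D k)"
      using chem_dist_gt[of _ k] path_connected_to_if_conn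
      by (intro emeasure_mono D) (auto simp: S_def D_def C_def d_def connection_event_def)
    finally show ?thesis .
  qed
  have harmonic_le: "ennreal (\<Sum>k<n. 1 / (144 * real (Suc k))) \<le> L" for n
  proof -
    have "ennreal (\<Sum>k<n. 1 / (144 * real (Suc k))) = (\<Sum>k<n. ennreal (1 / (144 * real (Suc k))))"
      by (rule sum_ennreal[symmetric]) simp
    also have "\<dots> \<le> (\<Sum>k<n. ennreal (2 * real k + 1) * emeasure critical_percolation (D k))"
    proof (rule sum_mono)
      fix k
      \<comment> \<open>Since \<open>2 * k + 3\<close> is at most \<open>3 * (k + 1)\<close>, each
        weighted tail is at least \<open>1 / (144 * (k + 1))\<close>, where 144 is 16 times
        9.\<close>
      have "1 / (144 * x) = x * (1 / (16 * (3 * x)\<^sup>2))" if "x > 0" for x :: real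
        using that by (simp add: field_simps power2_eq_square)
      from this[of "real k + 1"] have "1 / (144 * real (Suc k)) = (real k + 1) * (1 / (16 * (3 * (real k + 1))\<^sup>2))"
        by (simp add: add.commute)
      also have "\<dots> \<le> (2 * real k + 1) * (1 / (16 * (2 * real k + 3)\<^sup>2))"
        by (intro mult_mono divide_left_mono mult_left_mono power_mono mult_pos_pos zero_less_power) auto
      finally have "ennreal (1 / (144 * real (Suc k))) \<le> ennreal (2 * real k + 1) * ennreal (1 / (16 * (2 * real k + 3)\<^sup>2))"
        by (subst ennreal_mult[symmetric]) (auto intro: ennreal_leI)
      also have "\<dots> \<le> ennreal (2 * real k + 1) * emeasure critical_percolation (D k)"
        by (intro mult_left_mono tail) simp
      finally show "ennreal (1 / (144 * real (Suc k))) \<le> ennreal (2 * real k + 1) * emeasure critical_percolation (D k)" .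
    qed
    also have "\<dots> = (\<integral>\<^sup>+ \<omega>. (\<Sum>k<n. ennreal (2 * real k + 1) * indicator (D k) \<omega>) \<partial>critical_percolation)"
      by (subst nn_integral_sum) (simp_all only: nn_integral_cmult_indicator D, measurable)
    also have "\<dots> \<le> L"
      unfolding L_def
    proof (rule nn_integral_mono)
      fix \<omega> assume \<omega>: "\<omega> \<in> space critical_percolation"
      show "(\<Sum>k<n. ennreal (2 * real k + 1) * indicator (D k) \<omega>) \<le> ennreal ((real (d \<omega>))\<^sup>2) * indicator C \<omega>"
      proof (cases "\<omega> \<in> C")
        case True
        have "(\<Sum>k<n. ennreal (2 * real k + 1) * indicator (D k) \<omega>)
            = (\<Sum>k<n. ennreal (real ((2 * k + 1) * of_bool (k < d \<omega>))))"
          using \<omega> True by (intro sum.cong) (auto simp: D_def indicator_def)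
        also have "\<dots> = ennreal (real (\<Sum>k<n. (2 * k + 1) * of_bool (k < d \<omega>)))"
          unfolding of_nat_sum by (rule sum_ennreal) simp
        also have "\<dots> \<le> ennreal (real ((d \<omega>)\<^sup>2))"
          by (intro ennreal_leI of_nat_mono sum_odd_le_square)
        finally show ?thesis using True by simp
      next
        case False
        then show ?thesis by (simp add: D_def)
      qed
    qed
    finally show ?thesis .
  qed
  have "L = \<infinity>"
  proof (rule ccontr)
    assume "L \<noteq> \<infinity>"
    then obtain r where r: "L = ennreal r" "r \<ge> 0" by (cases L) auto
    have "(\<Sum>k<n. 1 / (144 * real (Suc k))) \<le> r" for n
      using harmonic_le[of n] r by simp
    then have "summable (\<lambda>k. 1 / (144 * real (Suc k)))"
      by (intro summableI_nonneg_bounded) auto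
    from summable_mult[OF this, of 144] have "summable (\<lambda>k. inverse (real (Suc k)))"
      by (rule summable_cong[THEN iffD1, rotated]) (simp add: field_simps del: of_nat_Suc)
    then show False
      using not_summable_harmonic[where 'a = real] summable_Suc_iff[of "\<lambda>k. inverse (real k)"] by blast
  qed
  moreover have "(\<integral>\<^sup>+ \<omega>. ennreal ((real (d \<omega>))\<^sup>2) \<partial>uniform_measure critical_percolation C)
      = L / emeasure critical_percolation C"
    unfolding L_def by (rule nn_integral_uniform_measure) simp_all
  \<comment> \<open>In \<open>ennreal\<close> an infinite value divided by an infinite one is 0, so
    the finiteness of the conditioning event enters the final division.\<close>
  moreover have "emeasure critical_percolation C \<noteq> \<infinity>"
    using prob_space.finite_measure[OF prob_space_critical_percolation]
    by (simp add: finite_measure.emeasure_finite)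
  ultimately show ?thesis
    unfolding C_def d_def by (simp add: ennreal_top_divide)
qed

end
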